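(* Assume the Continuum Hypothesis (CH). Then there exists a topological group $G$ whose underlying space is cometrizable such that $G$ contains a subspace homeomorphic to an uncountable subspace of the Sorgenfrey line (and hence $G$ is not cosmic), while the countable power $G^{\omega}$ is hereditarily Lindelöf (and hence $G^{\omega}$ has countable spread, i.e. $s(G^\omega)\le\omega$).
   Context: The Sorgenfrey line is the set of real numbers $\mathbb{R}$ endowed with the topology generated by the half-intervals $[a,b)$, where $a<b$ are arbitrary real numbers. A topological space $X$ is cosmic if it is a continuous image of a separable metrizable space. A topological space $X$ is cometrizable if $X$ admits a weaker (i.e. coarser, not necessarily strictly) metrizable topology such that each point of $X$ has a neighborhood base in the original topology of $X$ (consisting of not necessarily open neighborhoods) whose members are closed in the metrizable topology. For a topological space $Y$, the spread of $Y$ is the cardinal $s(Y)=\sup\{|D| : D\subset Y \text{ is a discrete subspace of } Y\}$. The power $G^\omega$ carries the Tychonoff product topology. A space is hereditarily Lindelöf if each of its subspaces is Lindelöf. *)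

theory Defs
  imports "HOL-Analysis.Analysis" "HOL-Algebra.Group"
begin

unbundle cardinal_syntax

definition continuum_hypothesis :: bool where
  "continuum_hypothesis \<longleftrightarrow> |UNIV :: real set| =o cardSuc natLeq"

definition sorgenfrey_line :: "real topology" where
  "sorgenfrey_line = topology_generated_by {{a..<b} | a b. a < b}"

definition topological_group :: "('a, 'b) monoid_scheme \<Rightarrow> 'a topology \<Rightarrow> bool" where
  "topological_group G T \<longleftrightarrow>
     group G \<and> topspace T = carrier G \<and>
     continuous_map (prod_topology T T) T (\<lambda>(x, y). x \<otimes>\<^bsub>G\<^esub> y) \<and>
     continuous_map T T (\<lambda>x. inv\<^bsub>G\<^esub> x)"

text \<open>The members of a neighbourhood base in the sense of \<^const>\<open>neighbourhood_base_of\<close> need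
  not be open.\<close>

definition cometrizable :: "'a topology \<Rightarrow> bool" where
  "cometrizable X \<longleftrightarrow>
     (\<exists>M. metrizable_space M \<and> topspace M = topspace X \<and>
          (\<forall>U. openin M U \<longrightarrow> openin X U) \<and>
          neighbourhood_base_of (closedin M) X)"

text \<open>A separable metrizable space has at most continuum many points, so it is no restriction to
  let the points of the space mapped onto \<open>X\<close> be reals; see \<open>cosmicI\<close> below.\<close>

definition cosmic :: "'a topology \<Rightarrow> bool" where
  "cosmic X \<longleftrightarrow>
     (\<exists>(M :: real topology) f. metrizable_space M \<and> separable_space M \<and>
          continuous_map M X f \<and> f ` topspace M = topspace X)"

definition hereditarily_Lindelof :: "'a topology \<Rightarrow> bool" where
  "hereditarily_Lindelof X \<longleftrightarrow> (\<forall>S \<subseteq> topspace X. Lindelof_space (subtopology X S))"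

definition discrete_subspace :: "'a topology \<Rightarrow> 'a set \<Rightarrow> bool" where
  "discrete_subspace X D \<longleftrightarrow> D \<subseteq> topspace X \<and> subtopology X D = discrete_topology D"

text \<open>The spread is the least upper bound of the cardinals \<open>|D|\<close>. Cardinals are well-order
  relations up to isomorphism, so the supremum is only determined up to \<open>=o\<close>, and \<open>spread\<close> picks
  a representative.\<close>

definition is_spread :: "'a topology \<Rightarrow> 'a rel \<Rightarrow> bool" where
  "is_spread X \<kappa> \<longleftrightarrow>
     Card_order \<kappa> \<and> (\<forall>D. discrete_subspace X D \<longrightarrow> |D| \<le>o \<kappa>) \<and>
     (\<forall>\<kappa>' :: 'a rel. Card_order \<kappa>' \<and> (\<forall>D. discrete_subspace X D \<longrightarrow> |D| \<le>o \<kappa>') \<longrightarrow> \<kappa> \<le>o \<kappa>')"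

definition spread :: "'a topology \<Rightarrow> 'a rel" where
  "spread X = (SOME \<kappa>. is_spread X \<kappa>)"

lemma is_spread_spread: "is_spread X (spread X)"
proof -
  let ?R = "{\<kappa> :: 'a rel. Card_order \<kappa> \<and> (\<forall>D. discrete_subspace X D \<longrightarrow> |D| \<le>o \<kappa>)}"
  have "|UNIV :: 'a set| \<in> ?R"
    by (simp add: card_of_Card_order card_of_mono1)
  then have "\<exists>r \<in> ?R. \<forall>r' \<in> ?R. r \<le>o r'"
    by (intro exists_minim_Card_order) auto
  then have "\<exists>\<kappa>. is_spread X \<kappa>"
    unfolding is_spread_def by blast
  then show ?thesis
    unfolding spread_def by (rule someI_ex)
qed

lemma separable_metrizable_lepoll_reals:
  fixes M :: "'b topology"
  assumes "metrizable_space M" "separable_space M"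
  shows "topspace M \<lesssim> (UNIV :: real set)"
proof -
  obtain S d where Sd: "Metric_space S d" and M: "M = Metric_space.mtopology S d"
    using assms(1) unfolding metrizable_space_def by blast
  interpret Metric_space S d by (rule Sd)
  obtain C where C: "countable C" "C \<subseteq> S" "mtopology closure_of C = S"
    using assms(2) unfolding M separable_space_def by auto
  let ?Q = "C \<times> (\<rat> :: real set)"
  have cQ: "countable ?Q"
    using C(1) countable_rat by blast
  define g where "g x = to_nat_on ?Q ` {(c, q) \<in> ?Q. d c x < q}" for x
  have "inj_on g S"
  proof (rule inj_onI, rule ccontr)
    fix x y assume xy: "x \<in> S" "y \<in> S" "g x = g y" "x \<noteq> y"
    have sets: "{(c, q) \<in> ?Q. d c x < q} = {(c, q) \<in> ?Q. d c y < q}"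
      using xy(3) unfolding g_def
      by (subst (asm) inj_on_image_eq_iff[OF inj_on_to_nat_on[OF cQ]]) auto
    define e where "e = d x y / 2"
    have e: "e > 0" using xy by (simp add: e_def)
    obtain c where c: "c \<in> C" "d x c < e"
      using C(3) xy(1) e unfolding metric_closure_of by (force simp: in_mball)
    obtain q :: real where q: "q \<in> \<rat>" "d x c < q" "q < e"
      using Rats_dense_in_real[OF c(2)] by blast
    have "(c, q) \<in> {(c, q) \<in> ?Q. d c x < q}"
      using c q by (simp add: commute)
    then have "d c y < q" using sets by auto
    moreover have "d x y \<le> d x c + d c y"
      using triangle c(1) C(2) xy by blast
    ultimately show False using q(2,3) by (simp add: e_def)
  qed
  then have "S \<lesssim> (UNIV :: nat set set)"
    unfolding lepoll_def by blast
  also have "(UNIV :: nat set set) \<approx> (UNIV :: real set)"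
    using nat_sets_eqpoll_reals .
  finally show ?thesis by (simp add: M)
qed

lemma cosmicI:
  fixes M :: "'b topology" and X :: "'a topology"
  assumes "metrizable_space M" "separable_space M" "continuous_map M X f"
    "f ` topspace M = topspace X"
  shows "cosmic X"
proof -
  obtain h :: "'b \<Rightarrow> real" where h: "inj_on h (topspace M)"
    using separable_metrizable_lepoll_reals[OF assms(1,2)] unfolding lepoll_def by blast
  define k where "k = inv_into (topspace M) h"
  have kh: "k (h x) = x" if "x \<in> topspace M" for x
    using that h by (simp add: k_def)
  define N where "N = pullback_topology (h ` topspace M) k M"
  have topN: "topspace N = h ` topspace M"
    using kh by (auto simp: N_def topspace_pullback_topology)
  have k: "continuous_map N M k"
    using continuous_map_pullback[OF continuous_map_id, of "h ` topspace M" k M]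
    by (simp add: N_def)
  have hc: "continuous_map M N h"
    unfolding N_def
    by (rule continuous_map_pullback')
      (auto intro!: continuous_map_eq[OF continuous_map_id] simp: kh)
  have "homeomorphic_maps N M k h"
    using k hc kh topN by (auto simp: homeomorphic_maps_def)
  then have "N homeomorphic_space M"
    unfolding homeomorphic_space_def by blast
  then have "metrizable_space N"
    using assms(1) homeomorphic_metrizable_space by blast
  moreover have "separable_space N"
    using separable_space_continuous_map_image[OF assms(2) hc] topN
    by (metis subtopology_topspace)
  moreover have "continuous_map N X (f \<circ> k)"
    using continuous_map_compose[OF k assms(3)] .
  moreover have "(f \<circ> k) ` topspace N = topspace X"
    using assms(4) kh by (force simp: topN image_image)
  ultimately show ?thesis
    unfolding cosmic_def by blast
qed

text \<open>A cometrizable space \<open>X\<close> with \<open>X\<^sup>\<omega>\<close> hereditarily Lindelof is Lindelof itself, so by the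
  following lemma a group of this kind can always be realised with real numbers as elements, its
  topology being unrelated to the usual topology of the reals.\<close>

lemma metrizable_Lindelof_imp_separable:
  assumes "metrizable_space M" "Lindelof_space M"
  shows "separable_space M"
proof -
  obtain S d where Sd: "Metric_space S d" and M: "M = Metric_space.mtopology S d"
    using assms(1) unfolding metrizable_space_def by blast
  interpret Metric_space S d by (rule Sd)
  have "\<exists>C. countable C \<and> C \<subseteq> S \<and> S \<subseteq> (\<Union>c\<in>C. mball c (inverse (Suc n)))" for n
  proof -
    let ?U = "(\<lambda>c. mball c (inverse (Suc n))) ` S"
    have U: "\<Union>?U = topspace mtopology"
      by (auto simp: in_mball)
    obtain V where V: "countable V" "V \<subseteq> ?U" "\<Union>V = S"
      using assms(2)[unfolded M Lindelof_space_def, rule_format, of ?U] U by auto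
    obtain C where "countable C" "C \<subseteq> S" "V = (\<lambda>c. mball c (inverse (Suc n))) ` C"
      using V(1,2) countable_subset_image by metis
    then show ?thesis using V(3) by blast
  qed
  then obtain C where C: "\<And>n. countable (C n)" "\<And>n. C n \<subseteq> S"
      "\<And>n. S \<subseteq> (\<Union>c\<in>C n. mball c (inverse (Suc n)))"
    by metis
  have "x \<in> mtopology closure_of (\<Union>n. C n)" if x: "x \<in> S" for x
  proof -
    have "\<exists>y \<in> (\<Union>n. C n). y \<in> mball x r" if r: "r > 0" for r
    proof -
      obtain n where n: "inverse (Suc n) < r"
        using reals_Archimedean[OF r] by blast
      obtain c where "c \<in> C n" "x \<in> mball c (inverse (Suc n))"
        using C(3) x by blast
      then show ?thesis
        using n by (force simp: in_mball commute)
    qed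
    then show ?thesis
      unfolding metric_closure_of using x by blast
  qed
  then have "mtopology closure_of (\<Union>n. C n) = S"
    using closure_of_subset_topspace[of mtopology] by auto
  then show ?thesis
    unfolding M separable_space_def using C(1,2)
    by (intro exI[of _ "\<Union>n. C n"]) auto
qed

lemma cometrizable_Lindelof_lepoll_reals:
  assumes "cometrizable X" "Lindelof_space X"
  shows "topspace X \<lesssim> (UNIV :: real set)"
proof -
  obtain M where M: "metrizable_space M" "topspace M = topspace X"
      "\<And>U. openin M U \<Longrightarrow> openin X U"
    using assms(1) unfolding cometrizable_def by blast
  have "Lindelof_space M"
    using assms(2) M(2,3) unfolding Lindelof_space_def by metis
  then show ?thesis
    using separable_metrizable_lepoll_reals metrizable_Lindelof_imp_separable M(1,2) by metis
qed

end

theory Submission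
  imports Defs "HOL-Library.Countable_Set_Type"
begin

text \<open>The group consists of sets of reals under symmetric difference. For a set \<open>A\<close> of positive
  reals, let \<open>G\<close> be the Boolean group generated by the intervals \<open>[0,a)\<close> with \<open>a \<in> A\<close>; its elements
  are finite unions of half-open intervals. A basic neighbourhood of \<open>S\<close> consists of the \<open>S'\<close> for
  which the symmetric difference \<open>D\<close> of \<open>S\<close> and \<open>S'\<close> has measure at most \<open>e\<close> and, for each \<open>t\<close> in a
  finite set \<open>F\<close>, fills at most the proportion \<open>e\<close> of every interval \<open>[s,t)\<close> that ends at \<open>t\<close>
  (\<open>small F e D\<close>). These conditions are monotone and subadditive in \<open>D\<close>, so they define a group
  topology. Each of them is an upper bound for a function that is continuous in the measure metric
  \<open>(S, S') \<mapsto> measure D\<close>, so the basic neighbourhoods are closed for that metric: the group is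
  cometrizable.

  The symmetric difference of \<open>[0,a)\<close> and \<open>[0,b)\<close> is the half-open interval between \<open>a\<close> and \<open>b\<close>. If
  \<open>b < a\<close>, it fills all of \<open>[b,a)\<close>, so that with \<open>t = a\<close> the points \<open>b < a\<close> are kept away from \<open>a\<close>,
  whereas \<open>[a,b)\<close> is as small as desired when \<open>b\<close> decreases to \<open>a\<close>. Hence \<open>a \<mapsto> [0,a)\<close> embeds \<open>A\<close> with
  the Sorgenfrey topology (\<open>Sorgenfrey_embedding\<close>). If \<open>A\<close> is uncountable, \<open>G\<close> has no countable
  network, so it is not cosmic.

  An element of \<open>G\<close> is described by a finite list of members of \<open>A\<close>, and depends continuously on that
  list in the Sorgenfrey topology. A neighbourhood in \<open>G\<^sup>\<omega>\<close> restricts finitely many coordinates,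
  so \<open>G\<^sup>\<omega>\<close> is hereditarily Lindelof once all finite Sorgenfrey powers of \<open>A\<close> are. After cutting
  into small boxes this becomes a statement about the order alone, \<open>countably_dominated A\<close>: every
  family of finite tuples from \<open>A\<close> has a countable subfamily such that each member of the family lies
  coordinatewise above some member of the subfamily.

  CH serves to find an uncountable \<open>A\<close> of this kind. Well-order the reals such that all initial
  segments are countable, and let every real code a countable set of tuples. A real is generic if it is
  not the infimum of the \<open>k\<close>-th coordinates of those tuples, from a set with an earlier code, that lie
  below bounds which are earlier reals or rationals. Each point has only countably many values to avoid, and
  the generic reals are uncountable. Given a family of tuples of generic reals, take a countable
  subfamily that is dense from above. If a tuple \<open>y\<close> of the family has distinct coordinates which all come
  after the code of the subfamily, then genericity, applied to the latest coordinate first, improves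
  ``there are members below \<open>y + \<eta>\<close> for every \<open>\<eta> > 0\<close>'' to ``there is a member below \<open>y\<close>''. The other
  tuples have a coordinate with one of countably many values, or two equal coordinates, and an
  induction on the number of coordinates handles them.\<close>

section \<open>Generic reals under the Continuum Hypothesis\<close>

text \<open>The cardinal of the reals is represented by a well-order of the reals themselves all of whose
  proper initial segments have smaller cardinality; under CH this means that they are countable.\<close>

lemma CH_wellorder:
  assumes "continuum_hypothesis"
  obtains r :: "real rel" where "Well_order r" "Field r = UNIV" "\<And>x. countable (underS r x)"
proof
  let ?r = "|UNIV :: real set|"
  show "Well_order ?r" "Field ?r = UNIV"
    by (rule card_of_Well_order, rule Field_card_of)
  show "countable (underS ?r x)" for x
  proof -
    have "|underS ?r x| <o ?r"
      by (rule card_of_underS[OF card_of_Card_order]) (simp only: Field_card_of UNIV_I)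
    then have "|underS ?r x| <o cardSuc natLeq"
      using assms unfolding continuum_hypothesis_def by (rule ordLess_ordIso_trans)
    then have "|underS ?r x| \<le>o natLeq"
      by (simp only: cardSuc_ordLeq_ordLess[OF natLeq_Card_order card_of_Card_order])
    then show ?thesis
      by (simp add: countable_card_le_natLeq)
  qed
qed

text \<open>A real is as good as a set of naturals, and a double sequence of such sets is again one.\<close>

lemma code_sequences:
  obtains c :: "real \<Rightarrow> nat \<Rightarrow> nat \<Rightarrow> real" where "surj c"
proof -
  obtain b :: "real \<Rightarrow> nat set" where b: "bij b"
    using nat_sets_eqpoll_reals eqpoll_sym unfolding eqpoll_def by blast
  define c where
    "c t n i = inv_into UNIV b {k. prod_encode (n, prod_encode (i, k)) \<in> b t}" for t n i
  have "f \<in> range c" for f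
  proof
    let ?T = "{prod_encode (n, prod_encode (i, k)) | n i k. k \<in> b (f n i)}"
    have "{k. prod_encode (n, prod_encode (i, k)) \<in> ?T} = b (f n i)" for n i
      by auto
    then show "f = c (inv_into UNIV b ?T)"
      using b by (intro ext) (simp add: c_def bij_is_surj bij_is_inj surj_f_inv_f)
  qed simp
  then show thesis
    using that by blast
qed

locale CH_enumeration =
  fixes r :: "real rel" and c :: "real \<Rightarrow> nat \<Rightarrow> nat \<Rightarrow> real"
  assumes wo: "Well_order r" and field: "Field r = UNIV"
    and countable_below: "\<And>x. countable (underS r x)"
    and surj_c: "surj c"
begin

text \<open>\<open>gap \<xi> J k y\<close> is the threshold in coordinate \<open>k\<close> of the upward closure of the set of tuples
  coded by \<open>\<xi>\<close>, along the section given by the bounds \<open>y\<close> on the coordinates in \<open>J\<close>. The rationals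
  are admitted as bounds in \<open>gaps\<close> so that a coordinate can be dealt with before it is known: it is
  first replaced by a rational slightly above it.\<close>

definition gap :: "real \<Rightarrow> nat set \<Rightarrow> nat \<Rightarrow> (nat \<Rightarrow> real) \<Rightarrow> real" where
  "gap \<xi> J k y = Inf {z k | z. z \<in> range (c \<xi>) \<and> (\<forall>j\<in>J. z j < y j)}"

definition gaps :: "real set \<Rightarrow> real set" where
  "gaps M = {gap \<xi> J k y | \<xi> J k y. \<xi> \<in> M \<and> finite J \<and> y \<in> J \<rightarrow>\<^sub>E M \<union> \<rat>}"

definition generic :: "real set" where
  "generic = {x. x \<notin> gaps (underS r x)}"

lemma below_linear: "x = y \<or> x \<in> underS r y \<or> y \<in> underS r x"
  using wo field unfolding well_order_on_def linear_order_on_def total_on_def underS_def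
  by auto

lemma countable_gaps:
  assumes "countable M" shows "countable (gaps M)"
proof -
  have "gaps M \<subseteq> (\<Union>J\<in>Collect finite. (\<lambda>(\<xi>, k, y). gap \<xi> J k y) ` (M \<times> UNIV \<times> (J \<rightarrow>\<^sub>E M \<union> \<rat>)))"
  proof
    fix x assume "x \<in> gaps M"
    then obtain \<xi> J k y where "x = gap \<xi> J k y" "\<xi> \<in> M" "finite J" "y \<in> J \<rightarrow>\<^sub>E M \<union> \<rat>"
      unfolding gaps_def by blast
    then show "x \<in> (\<Union>J\<in>Collect finite. (\<lambda>(\<xi>, k, y). gap \<xi> J k y) ` (M \<times> UNIV \<times> (J \<rightarrow>\<^sub>E M \<union> \<rat>)))"
      by (intro UN_I[of J] image_eqI[of _ _ "(\<xi>, k, y)"]) simp_all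
  qed
  moreover have "countable (J \<rightarrow>\<^sub>E M \<union> \<rat>)" if "finite J" for J :: "nat set"
    using that assms countable_rat by (intro countable_PiE) auto
  ultimately show ?thesis
    by (elim countable_subset, intro countable_UN countable_Collect_finite countable_image
        countable_SIGMA assms) auto
qed

text \<open>A countable set \<open>M\<close> that is closed under \<open>gaps\<close> does not contain all generic reals: everything
  before the first real \<open>x\<close> outside \<open>M\<close> is in \<open>M\<close>, so \<open>x\<close> is not a gap over its predecessors.\<close>

lemma uncountable_generic: "uncountable generic"
proof
  assume "countable generic"
  define N where "N = rec_nat generic (\<lambda>_ M. M \<union> gaps M)"
  have N_simps: "N 0 = generic" "\<And>n. N (Suc n) = N n \<union> gaps (N n)"
    by (simp_all add: N_def)
  have cN: "countable (N n)" for n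
    by (induction n) (use \<open>countable generic\<close> countable_gaps in \<open>auto simp: N_simps\<close>)
  have mono: "N m \<subseteq> N n" if "m \<le> n" for m n
    using that by (rule lift_Suc_mono_le[rotated]) (auto simp: N_simps)
  define M where "M = (\<Union>n. N n)"
  have "countable M"
    using cN by (simp add: M_def)
  then have "- M \<noteq> {}"
    using uncountable_UNIV_real by (metis Compl_empty_eq double_compl)
  moreover have "wf (r - Id)"
    using wo by (simp add: well_order_on_def)
  ultimately obtain x where x: "x \<notin> M" and least: "\<And>y. (y, x) \<in> r - Id \<Longrightarrow> y \<in> M"
    by (metis ComplD ComplI ex_in_conv wfE_min)
  have below: "underS r x \<subseteq> M"
    using least by (auto simp: underS_def)
  have "x \<in> gaps (underS r x)"
    using x N_simps(1) unfolding M_def generic_def by blast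
  then obtain \<xi> J k y where *: "x = gap \<xi> J k y" "\<xi> \<in> M" "finite J" "y \<in> J \<rightarrow>\<^sub>E M \<union> \<rat>"
    using below unfolding gaps_def by (blast dest: PiE_mono[THEN subsetD, rotated])
  have "\<forall>j\<in>J. \<exists>n. y j \<in> N n \<union> \<rat>"
    using *(4) by (fastforce simp: M_def PiE_iff)
  then obtain n where n: "\<And>j. j \<in> J \<Longrightarrow> y j \<in> N (n j) \<union> \<rat>"
    by metis
  obtain n0 where n0: "\<xi> \<in> N n0"
    using *(2) by (auto simp: M_def)
  define m where "m = Max (insert n0 (n ` J))"
  have m: "n0 \<le> m" "\<And>j. j \<in> J \<Longrightarrow> n j \<le> m"
    using *(3) by (auto simp: m_def)
  have "\<xi> \<in> N m"
    using n0 mono[OF m(1)] by blast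
  moreover have "y \<in> J \<rightarrow>\<^sub>E N m \<union> \<rat>"
  proof (rule PiE_I)
    fix j assume "j \<in> J"
    then show "y j \<in> N m \<union> \<rat>"
      using n[of j] mono[OF m(2)[of j]] by blast
  next
    fix j assume "j \<notin> J"
    then show "y j = undefined"
      using *(4) by (rule PiE_arb[rotated])
  qed
  ultimately have "x \<in> gaps (N m)"
    unfolding gaps_def mem_Collect_eq using *(1,3)
    by (intro exI[of _ \<xi>] exI[of _ J] exI[of _ k] exI[of _ y]) simp
  then have "x \<in> N (Suc m)"
    by (simp add: N_simps)
  then show False
    using x unfolding M_def by blast
qed

text \<open>Here \<open>I\<close> indexes the coordinates in which only \<open>x i < y i + \<eta>\<close> can be achieved so far, and \<open>L\<close>
  those with a rational bound. The coordinate \<open>m\<close> of \<open>I\<close> whose value comes last in the well-order is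
  replaced by rationals above it, and the induction hypothesis shows that the infimum of the possible
  \<open>m\<close>-th coordinates, subject to the strict bounds elsewhere, is at most \<open>y m\<close>. All those bounds are
  rational or come before \<open>y m\<close>, so by genericity this infimum differs from \<open>y m\<close>.\<close>

lemma generic_below_limit:
  assumes "finite I" "finite L" "I \<inter> L = {}"
    and "\<And>i. i \<in> I \<Longrightarrow> y i \<in> generic \<and> \<xi> \<in> underS r (y i)" "inj_on y I"
    and "\<And>i. i \<in> L \<Longrightarrow> y i \<in> \<rat>"
    and "\<And>\<eta>. \<eta> > 0 \<Longrightarrow> \<exists>x\<in>range (c \<xi>). (\<forall>i\<in>I. x i < y i + \<eta>) \<and> (\<forall>i\<in>L. x i < y i)"
  shows "\<exists>x\<in>range (c \<xi>). \<forall>i\<in>I \<union> L. x i < y i"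
  using assms
proof (induction "card I" arbitrary: I L y)
  case 0
  then have "I = {}" by simp
  then show ?case using "0.prems"(7)[of 1] by auto
next
  case (Suc n)
  have "finite (y ` I)" "y ` I \<noteq> {}"
    using Suc.hyps(2) Suc.prems(1) by auto
  have "wf ((r - Id)\<inverse> \<inter> (y ` I \<times> y ` I))"
  proof (rule finite_acyclic_wf)
    show "finite ((r - Id)\<inverse> \<inter> (y ` I \<times> y ` I))"
      using \<open>finite (y ` I)\<close> by simp
    have "wf (r - Id)" using wo by (simp add: well_order_on_def)
    then have "acyclic ((r - Id)\<inverse>)"
      by (simp add: wf_acyclic)
    then show "acyclic ((r - Id)\<inverse> \<inter> (y ` I \<times> y ` I))"
      by (rule acyclic_subset) simp
  qed
  then obtain v where "v \<in> y ` I" and "\<And>w. (w, v) \<in> (r - Id)\<inverse> \<inter> (y ` I \<times> y ` I) \<Longrightarrow> w \<notin> y ` I"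
    using \<open>y ` I \<noteq> {}\<close> by (metis ex_in_conv wfE_min)
  then obtain m where m: "m \<in> I" and max: "\<And>i. i \<in> I \<Longrightarrow> (y m, y i) \<notin> r - Id"
    by blast
  have below: "y i \<in> underS r (y m)" if "i \<in> I - {m}" for i
  proof -
    have "y i \<noteq> y m" using that m Suc.prems(5) by (auto dest: inj_onD)
    then show ?thesis
      using below_linear[of "y i" "y m"] max[of i] that by (auto simp: underS_def)
  qed
  define J where "J = (I - {m}) \<union> L"
  define Z where "Z = {z m | z. z \<in> range (c \<xi>) \<and> (\<forall>j\<in>J. z j < y j)}"
  have mL: "m \<notin> L"
    using Suc.prems(3) m by blast
  have Z: "\<exists>v\<in>Z. v < q" if "y m < q" for q
  proof -
    obtain p :: real where p: "p \<in> \<rat>" "y m < p" "p < q"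
      using Rats_dense_in_real[OF \<open>y m < q\<close>] by blast
    let ?y = "y(m := p)"
    have "\<exists>x\<in>range (c \<xi>). \<forall>i\<in>(I - {m}) \<union> insert m L. x i < ?y i"
    proof (rule Suc.hyps(1))
      show "n = card (I - {m})" "finite (I - {m})" "finite (insert m L)" "(I - {m}) \<inter> insert m L = {}"
        using Suc.hyps(2) Suc.prems(1,2,3) m by auto
      show "?y i \<in> generic \<and> \<xi> \<in> underS r (?y i)" if "i \<in> I - {m}" for i
        using that Suc.prems(4) by auto
      show "inj_on ?y (I - {m})"
        using Suc.prems(5) by (auto simp: inj_on_def)
      show "?y i \<in> \<rat>" if "i \<in> insert m L" for i
        using that Suc.prems(6) p(1) by auto
      fix \<eta> :: real assume "\<eta> > 0"
      then have "min \<eta> (p - y m) > 0"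
        using p(2) by simp
      then obtain x where x: "x \<in> range (c \<xi>)" "\<forall>i\<in>I. x i < y i + min \<eta> (p - y m)"
          "\<forall>i\<in>L. x i < y i"
        using Suc.prems(7) by blast
      then show "\<exists>x\<in>range (c \<xi>). (\<forall>i\<in>I - {m}. x i < ?y i + \<eta>) \<and> (\<forall>i\<in>insert m L. x i < ?y i)"
        using m mL by (intro bexI[of _ x]) force+
    qed
    then obtain x where x: "x \<in> range (c \<xi>)" "\<forall>i\<in>(I - {m}) \<union> insert m L. x i < ?y i"
      by blast
    then have "\<forall>j\<in>J. x j < y j"
      using mL by (auto simp: J_def split: if_splits)
    then have "x m \<in> Z"
      unfolding Z_def using x(1) by blast
    moreover have "x m < q" using x(2) p(3) by force
    ultimately show ?thesis by blast
  qed
  have "\<exists>v\<in>Z. v < y m"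
  proof (rule ccontr)
    assume "\<not> ?thesis"
    then have ge: "\<And>v. v \<in> Z \<Longrightarrow> y m \<le> v" by force
    have "Inf Z = y m"
    proof (rule cInf_eq_non_empty)
      show "Z \<noteq> {}"
        using Z[of "y m + 1"] by auto
      show "w \<le> y m" if "\<And>v. v \<in> Z \<Longrightarrow> w \<le> v" for w
        using Z[of w] that by force
    qed (rule ge)
    moreover have "Z = {z m | z. z \<in> range (c \<xi>) \<and> (\<forall>j\<in>J. z j < restrict y J j)}"
      by (auto simp: Z_def)
    ultimately have "y m = gap \<xi> J m (restrict y J)"
      by (simp add: gap_def)
    moreover have "finite J" "restrict y J \<in> J \<rightarrow>\<^sub>E underS r (y m) \<union> \<rat>"
      using Suc.prems(1,2,6) below by (auto simp: J_def)
    ultimately have "y m \<in> gaps (underS r (y m))"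
      using Suc.prems(4)[OF m] unfolding gaps_def by blast
    then show False
      using Suc.prems(4)[OF m] by (simp add: generic_def)
  qed
  then show ?case
    unfolding Z_def J_def using m by blast
qed

text \<open>Tuples with distinct coordinates that all come after the code \<open>\<xi>\<close> of a subfamily dense from
  above are covered by \<open>generic_below_limit\<close>. The remaining ones have a coordinate in the countable
  set \<open>V\<close> of values up to \<open>\<xi>\<close>, or a repeated coordinate; on each of these countably many subfamilies
  one coordinate takes care of itself and the induction hypothesis handles the others.\<close>

lemma generic_dominating_subset:
  fixes S :: "(nat \<Rightarrow> real) set"
  assumes "finite I" "\<And>s i. s \<in> S \<Longrightarrow> i \<in> I \<Longrightarrow> s i \<in> generic"
  shows "\<exists>C\<subseteq>S. countable C \<and> (\<forall>s\<in>S. \<exists>t\<in>C. \<forall>i\<in>I. t i \<le> s i)"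
  using assms
proof (induction "card I" arbitrary: I S)
  case 0
  show ?case
  proof (cases "S = {}")
    case False
    then obtain s where "s \<in> S" by blast
    then show ?thesis using 0 by (intro exI[of _ "{s}"]) auto
  qed simp
next
  case (Suc n)
  have IH: "\<exists>C\<subseteq>S'. countable C \<and> (\<forall>s\<in>S'. \<exists>t\<in>C. \<forall>j\<in>I - {i}. t j \<le> s j)"
    if "i \<in> I" "S' \<subseteq> S" for i S'
    using that Suc.prems Suc.hyps(2) by (intro Suc.hyps(1)) auto
  show ?case
  proof (cases "S = {}")
    case False
    \<comment> \<open>a countable subfamily that approximates every member of \<open>S\<close> from above\<close>
    define f where "f q = (SOME s. s \<in> S \<and> (\<forall>i\<in>I. s i < q i))" for q
    define Q where "Q = {q \<in> I \<rightarrow>\<^sub>E \<rat>. \<exists>s\<in>S. \<forall>i\<in>I. s i < q i}"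
    have f: "f q \<in> S \<and> (\<forall>i\<in>I. f q i < q i)" if "q \<in> Q" for q
    proof -
      have "\<exists>s. s \<in> S \<and> (\<forall>i\<in>I. s i < q i)"
        using that unfolding Q_def by blast
      then show ?thesis
        unfolding f_def by (rule someI_ex)
    qed
    have "Q \<subseteq> I \<rightarrow>\<^sub>E \<rat>"
      by (auto simp: Q_def)
    then have "countable Q"
      by (rule countable_subset) (intro countable_PiE Suc.prems(1) countable_rat)
    have approx: "\<exists>t\<in>f ` Q. \<forall>i\<in>I. t i < s i + \<eta>" if "s \<in> S" "\<eta> > 0" for s \<eta>
    proof -
      have "\<exists>q\<in>\<rat>. s i < q \<and> q < s i + \<eta>" for i
        using Rats_dense_in_real[of "s i" "s i + \<eta>"] \<open>\<eta> > 0\<close> by auto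
      then obtain q where q: "\<And>i. q i \<in> \<rat>" "\<And>i. s i < q i" "\<And>i. q i < s i + \<eta>"
        by metis
      then have Q: "restrict q I \<in> Q"
        using \<open>s \<in> S\<close> by (auto simp: Q_def)
      have "f (restrict q I) i < s i + \<eta>" if "i \<in> I" for i
        using f[OF Q] q(3)[of i] that by fastforce
      with Q show ?thesis
        by blast
    qed
    have "f ` Q \<noteq> {}" "countable (f ` Q)"
      using approx[of _ 1] False \<open>countable Q\<close> by auto
    then obtain e :: "nat \<Rightarrow> nat \<Rightarrow> real" where "range e = f ` Q"
      by (metis range_from_nat_into)
    then obtain \<xi> where \<xi>: "range (c \<xi>) = f ` Q"
      using surj_c by (metis surjD)
    define V where "V = insert \<xi> (underS r \<xi>)"
    have "countable V" by (simp add: V_def countable_below)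
    define small where "small i v = {s \<in> S. s i = v}" for i v
    define equal where "equal i j = {s \<in> S. s i = s j}" for i j
    obtain C where C: "C i S' \<subseteq> S'" "countable (C i S')"
        "\<forall>s\<in>S'. \<exists>t\<in>C i S'. \<forall>j\<in>I - {i}. t j \<le> s j" if "i \<in> I" "S' \<subseteq> S" for i S'
      using IH by metis
    have sub: "small i v \<subseteq> S" "equal i j \<subseteq> S" for i v j
      by (auto simp: small_def equal_def)
    let ?D = "f ` Q \<union> (\<Union>i\<in>I. \<Union>v\<in>V. C i (small i v)) \<union> (\<Union>i\<in>I. \<Union>j\<in>I. C i (equal i j))"
    show ?thesis
    proof (intro exI[of _ ?D] conjI ballI)
      show "?D \<subseteq> S"
        using f C(1)[OF _ sub(1)] C(1)[OF _ sub(2)] sub by blast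
      show "countable ?D"
        using \<open>countable Q\<close> \<open>countable V\<close> C(2)[OF _ sub(1)] C(2)[OF _ sub(2)] Suc.prems(1)
        by (intro countable_Un countable_UN) (auto intro: countable_finite)
      fix s assume s: "s \<in> S"
      consider (new) "inj_on s I" "\<And>i. i \<in> I \<Longrightarrow> \<xi> \<in> underS r (s i)"
        | (small) i v where "i \<in> I" "v \<in> V" "s \<in> small i v"
        | (equal) i j where "i \<in> I" "j \<in> I" "i \<noteq> j" "s \<in> equal i j"
      proof -
        have "\<xi> \<in> underS r (s i) \<or> s i \<in> V" for i
          using below_linear[of \<xi> "s i"] by (auto simp: V_def)
        then show thesis
          using that s unfolding small_def equal_def inj_on_def
          by (metis (mono_tags, lifting) mem_Collect_eq)
      qed
      then show "\<exists>t\<in>?D. \<forall>i\<in>I. t i \<le> s i"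
      proof cases
        case new
        have "\<exists>z\<in>range (c \<xi>). \<forall>i\<in>I \<union> {}. z i < s i"
          using Suc.prems s new approx[OF s] by (intro generic_below_limit) (auto simp: \<xi>)
        then obtain q where q: "q \<in> Q" "\<forall>i\<in>I. f q i < s i"
          unfolding \<xi> by auto
        then show ?thesis
          by (intro bexI[of _ "f q"]) (auto intro: less_imp_le)
      next
        case small
        then obtain t where t: "t \<in> C i (small i v)" "\<forall>j\<in>I - {i}. t j \<le> s j"
          using C(3)[OF small(1) sub(1)] by blast
        moreover have "t i = s i"
          using t(1) C(1)[OF small(1) sub(1)] small(3) unfolding small_def by blast
        ultimately show ?thesis
          using small(1,2) by (intro bexI[of _ t]) (metis Diff_iff order_refl singletonD, blast)
      next
        case equal
        then obtain t where t: "t \<in> C i (equal i j)" "\<forall>j\<in>I - {i}. t j \<le> s j"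
          using C(3)[OF equal(1) sub(2)] by blast
        moreover have "t i = t j" "s i = s j"
          using t(1) C(1)[OF equal(1) sub(2)] equal(4) unfolding equal_def by blast+
        then have "t i \<le> s i"
          using t(2) equal(2,3) by auto
        ultimately show ?thesis
          using equal(1,2) by (intro bexI[of _ t]) (metis Diff_iff singletonD, blast)
      qed
    qed
  qed simp
qed

end

section \<open>Families of tuples over a generic set\<close>

definition countably_dominated :: "real set \<Rightarrow> bool" where
  "countably_dominated A \<longleftrightarrow>
     (\<forall>(I :: nat set) S. finite I \<and> (\<forall>s\<in>S. \<forall>i\<in>I. s i \<in> A) \<longrightarrow>
       (\<exists>C\<subseteq>S. countable C \<and> (\<forall>s\<in>S. \<exists>t\<in>C. \<forall>i\<in>I. t i \<le> s i)))"

lemma countably_dominatedD: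
  fixes I :: "nat set"
  assumes "countably_dominated A" "finite I" "\<And>s i. s \<in> S \<Longrightarrow> i \<in> I \<Longrightarrow> s i \<in> A"
  obtains C where "countable C" "C \<subseteq> S" "\<And>s. s \<in> S \<Longrightarrow> \<exists>t\<in>C. \<forall>i\<in>I. t i \<le> s i"
proof -
  have "\<exists>C\<subseteq>S. countable C \<and> (\<forall>s\<in>S. \<exists>t\<in>C. \<forall>i\<in>I. t i \<le> s i)"
    using assms(1)[unfolded countably_dominated_def, rule_format, of I S] assms(2,3) by simp
  then show thesis
    using that by auto
qed

lemma CH_imp_countably_dominated:
  assumes "continuum_hypothesis"
  obtains A where "uncountable A" "\<And>a. a \<in> A \<Longrightarrow> a > 0" "countably_dominated A"
proof -
  obtain r :: "real rel" where r: "Well_order r" "Field r = UNIV" "\<And>x. countable (underS r x)"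
    using CH_wellorder[OF assms] by blast
  obtain c :: "real \<Rightarrow> nat \<Rightarrow> nat \<Rightarrow> real" where c: "surj c"
    using code_sequences by blast
  interpret CH_enumeration r c
    using r c by unfold_locales
  \<comment> \<open>the property concerns the order alone, so the increasing function \<open>exp\<close> makes \<open>A\<close> positive\<close>
  show thesis
  proof (rule that[of "exp ` generic"])
    show "uncountable (exp ` generic)"
      using uncountable_generic by (simp add: countable_image_inj_eq inj_on_def)
    show "a > 0" if "a \<in> exp ` generic" for a
      using that by auto
    show "countably_dominated (exp ` generic)"
      unfolding countably_dominated_def
    proof (intro allI impI, elim conjE)
      fix I :: "nat set" and S :: "(nat \<Rightarrow> real) set"
      assume I: "finite I" and S: "\<forall>s\<in>S. \<forall>i\<in>I. s i \<in> exp ` generic"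
      let ?l = "\<lambda>(s :: nat \<Rightarrow> real) i. ln (s i)"
      have "\<exists>C\<subseteq>?l ` S. countable C \<and> (\<forall>s\<in>?l ` S. \<exists>t\<in>C. \<forall>i\<in>I. t i \<le> s i)"
        using S by (intro generic_dominating_subset[OF I]) force
      then obtain C where C: "countable C" "C \<subseteq> ?l ` S" "\<forall>s\<in>?l ` S. \<exists>t\<in>C. \<forall>i\<in>I. t i \<le> s i"
        by blast
      obtain D where D: "countable D" "D \<subseteq> S" "C = ?l ` D"
        using C(1,2) countable_subset_image[of C ?l S] by auto
      have "\<exists>t\<in>D. \<forall>i\<in>I. t i \<le> s i" if s: "s \<in> S" for s
      proof -
        obtain t where t: "t \<in> D" "\<forall>i\<in>I. ln (t i) \<le> ln (s i)"
          using bspec[OF C(3) imageI[OF s]] unfolding D(3) by auto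
        have "t i \<le> s i" if "i \<in> I" for i
        proof -
          have "t i > 0" "s i > 0"
            using S s t(1) D(2) that by fastforce+
          then show ?thesis using t(2)[rule_format, OF that] by simp
        qed
        then show ?thesis using t(1) by blast
      qed
      then show "\<exists>C\<subseteq>S. countable C \<and> (\<forall>s\<in>S. \<exists>t\<in>C. \<forall>i\<in>I. t i \<le> s i)"
        using D by blast
    qed
  qed
qed

text \<open>The finite powers of \<open>A\<close> in the Sorgenfrey topology are hereditarily Lindelof, formulated for an
  indexed family of tuples with a box \<open>\<Prod>[x, x + \<delta>)\<close> at each of them. The key of \<open>s\<close> records a scale
  finer than \<open>\<delta> s\<close> and the cube of that scale containing the tuple; for two tuples with the same key,
  being in the box of the other one means being coordinatewise above it.\<close>

lemma countable_Sorgenfrey_cover: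
  fixes x :: "'b \<Rightarrow> nat \<Rightarrow> real" and \<delta> :: "'b \<Rightarrow> real"
  assumes A: "countably_dominated A" and I: "finite I"
    and x: "\<And>s i. s \<in> S \<Longrightarrow> i \<in> I \<Longrightarrow> x s i \<in> A" and \<delta>: "\<And>s. s \<in> S \<Longrightarrow> \<delta> s > 0"
  shows "\<exists>C\<subseteq>S. countable C \<and> (\<forall>s\<in>S. \<exists>t\<in>C. \<forall>i\<in>I. x t i \<le> x s i \<and> x s i < x t i + \<delta> t)"
proof -
  obtain n where n: "\<And>s. s \<in> S \<Longrightarrow> inverse (real (Suc (n s))) < \<delta> s"
    using reals_Archimedean[OF \<delta>] by metis
  define key where "key s = (n s, restrict (\<lambda>i. \<lfloor>x s i * real (Suc (n s))\<rfloor>) I)" for s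
  have "key ` S \<subseteq> UNIV \<times> (I \<rightarrow>\<^sub>E UNIV)"
    by (auto simp: key_def)
  moreover have "countable ((UNIV :: nat set) \<times> (I \<rightarrow>\<^sub>E (UNIV :: int set)))"
    by (intro countable_SIGMA countable_PiE I) auto
  ultimately have keys: "countable (key ` S)"
    by (rule countable_subset)
  have "\<exists>C\<subseteq>{s\<in>S. key s = k}. countable C \<and> (\<forall>s\<in>{s\<in>S. key s = k}. \<exists>t\<in>C. \<forall>i\<in>I. x t i \<le> x s i)" for k
  proof -
    have in_A: "s i \<in> A" if "s \<in> x ` {s\<in>S. key s = k}" "i \<in> I" for s i
      using that x by auto
    obtain C where C: "countable C" "C \<subseteq> x ` {s\<in>S. key s = k}"
        "\<And>s. s \<in> x ` {s\<in>S. key s = k} \<Longrightarrow> \<exists>t\<in>C. \<forall>i\<in>I. t i \<le> s i"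
      by (rule countably_dominatedD[where S = "x ` {s\<in>S. key s = k}", OF A I]) (erule (1) in_A, blast)
    obtain D where D: "countable D" "D \<subseteq> {s\<in>S. key s = k}" "C = x ` D"
      using C(1,2) countable_subset_image[of C x] by auto
    then show ?thesis
      using C(3)[OF imageI] by (intro exI[of _ D]) auto
  qed
  then obtain C where C: "\<And>k. C k \<subseteq> {s\<in>S. key s = k}" "\<And>k. countable (C k)"
      "\<And>k s. s \<in> S \<Longrightarrow> key s = k \<Longrightarrow> \<exists>t\<in>C k. \<forall>i\<in>I. x t i \<le> x s i"
    by (simp add: Ball_def) metis
  show ?thesis
  proof (intro exI[of _ "\<Union>k\<in>key ` S. C k"] conjI ballI)
    show "(\<Union>k\<in>key ` S. C k) \<subseteq> S"
      using C(1) by blast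
    show "countable (\<Union>k\<in>key ` S. C k)"
      using keys C(2) by blast
    fix s assume s: "s \<in> S"
    then obtain t where t: "t \<in> C (key s)" "\<forall>i\<in>I. x t i \<le> x s i"
      using C(3) by blast
    then have "t \<in> S" and key: "key t = key s"
      using C(1) by blast+
    have "x s i < x t i + \<delta> t" if "i \<in> I" for i
    proof -
      let ?N = "real (Suc (n t))"
      have "n s = n t" "\<lfloor>x s i * ?N\<rfloor> = \<lfloor>x t i * ?N\<rfloor>"
        using key that arg_cong[OF key, of "\<lambda>p. snd p i"] by (simp_all add: key_def)
      then have "x s i * ?N < x t i * ?N + 1"
        by linarith
      then have "x s i < x t i + inverse ?N"
        by (simp add: field_simps)
      then show ?thesis using n[OF \<open>t \<in> S\<close>] by simp
    qed
    then show "\<exists>t\<in>(\<Union>k\<in>key ` S. C k). \<forall>i\<in>I. x t i \<le> x s i \<and> x s i < x t i + \<delta> t"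
      using s t by (intro bexI[of _ t]) auto
  qed
qed

section \<open>Step sets and their left density\<close>

fun step_set :: "real list \<Rightarrow> real set" where
  "step_set [] = {}"
| "step_set (a # as) = sym_diff {0..<a} (step_set as)"

lemma step_set_append: "step_set (as @ bs) = sym_diff (step_set as) (step_set bs)"
  by (induction as) auto

lemma fmeasurable_interval: "{a..<b :: real} \<in> fmeasurable lborel"
  by (rule fmeasurableI2[OF fmeasurable_cbox[of a b]]) auto

lemma step_set_fmeasurable: "step_set as \<in> fmeasurable lborel"
proof (induction as)
  case (Cons a as)
  have "{0..<a} \<in> fmeasurable lborel"
    by (rule fmeasurable_interval)
  with Cons show ?case
    by (auto intro!: fmeasurable.Un fmeasurable.Diff)
qed simp

text \<open>Constancy to the right of every point means that different step sets differ on a whole interval,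
  so they are separated by the measure and also by the rationals.\<close>

lemma step_set_locally_constant:
  "\<exists>\<delta>>0. \<forall>y. x \<le> y \<and> y < x + \<delta> \<longrightarrow> (y \<in> step_set as \<longleftrightarrow> x \<in> step_set as)"
proof (induction as)
  case Nil
  show ?case by (auto intro: exI[of _ 1])
next
  case (Cons a as)
  then obtain \<delta> where \<delta>: "\<delta> > 0"
      "\<forall>y. x \<le> y \<and> y < x + \<delta> \<longrightarrow> (y \<in> step_set as \<longleftrightarrow> x \<in> step_set as)"
    by blast
  define \<delta>' where "\<delta>' = (if x < 0 then - x else if x < a then a - x else 1)"
  have \<delta>': "\<delta>' > 0" "\<And>y. x \<le> y \<Longrightarrow> y < x + \<delta>' \<Longrightarrow> y \<in> {0..<a} \<longleftrightarrow> x \<in> {0..<a}"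
    by (auto simp: \<delta>'_def split: if_splits)
  show ?case
  proof (intro exI[of _ "min \<delta> \<delta>'"] conjI allI impI)
    show "0 < min \<delta> \<delta>'"
      using \<delta>(1) \<delta>'(1) by simp
    fix y assume "x \<le> y \<and> y < x + min \<delta> \<delta>'"
    then have "x \<le> y" "y < x + \<delta>" "y < x + \<delta>'"
      by linarith+
    then have "y \<in> step_set as \<longleftrightarrow> x \<in> step_set as" "y \<in> {0..<a} \<longleftrightarrow> x \<in> {0..<a}"
      using \<delta>(2) \<delta>'(2) by blast+
    then show "y \<in> step_set (a # as) \<longleftrightarrow> x \<in> step_set (a # as)"
      by simp
  qed
qed

lemma sym_diff_step_set_locally_constant:
  assumes "step_set as \<noteq> step_set bs"
  obtains x \<delta> where "\<delta> > 0" "{x..<x + \<delta>} \<subseteq> sym_diff (step_set as) (step_set bs)"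
proof -
  obtain x where "x \<in> step_set (as @ bs)"
    using assms by (auto simp: step_set_append)
  moreover obtain \<delta> where "\<delta> > 0"
      "\<forall>y. x \<le> y \<and> y < x + \<delta> \<longrightarrow> (y \<in> step_set (as @ bs) \<longleftrightarrow> x \<in> step_set (as @ bs))"
    using step_set_locally_constant by blast
  ultimately have "{x..<x + \<delta>} \<subseteq> step_set (as @ bs)"
    by (meson atLeastLessThan_iff subsetI)
  with \<open>\<delta> > 0\<close> show thesis
    by (intro that[of \<delta> x]) (simp_all add: step_set_append)
qed

lemma step_set_eqI_measure:
  assumes "measure lborel (sym_diff (step_set as) (step_set bs)) = 0"
  shows "step_set as = step_set bs"
proof (rule ccontr)
  assume "step_set as \<noteq> step_set bs"
  then obtain x \<delta> where *: "\<delta> > 0" "{x..<x + \<delta>} \<subseteq> sym_diff (step_set as) (step_set bs)"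
    by (rule sym_diff_step_set_locally_constant)
  have "measure lborel {x..<x + \<delta>} \<le> measure lborel (sym_diff (step_set as) (step_set bs))"
    using * step_set_fmeasurable[of "as @ bs"]
    by (intro measure_mono_fmeasurable) (auto simp: step_set_append)
  then show False using assms \<open>\<delta> > 0\<close> by simp
qed

lemma step_set_eqI_rational:
  assumes "step_set as \<inter> \<rat> = step_set bs \<inter> \<rat>"
  shows "step_set as = step_set bs"
proof (rule ccontr)
  assume "step_set as \<noteq> step_set bs"
  then obtain x \<delta> where *: "\<delta> > 0" "{x..<x + \<delta>} \<subseteq> sym_diff (step_set as) (step_set bs)"
    by (rule sym_diff_step_set_locally_constant)
  then obtain q where q: "q \<in> \<rat>" "x < q" "q < x + \<delta>"
    using Rats_dense_in_real[of x "x + \<delta>"] by auto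
  then have "q \<in> sym_diff (step_set as) (step_set bs)"
    by (intro subsetD[OF *(2)]) simp
  then show False using q(1) assms by blast
qed

text \<open>This allows the elements of the group to be coded by reals.\<close>

lemma step_sets_lepoll_reals: "range step_set \<lesssim> (UNIV :: real set)"
proof -
  have "range step_set \<lesssim> Pow (\<rat> :: real set)"
    unfolding lepoll_def
    by (intro exI[of _ "\<lambda>S. S \<inter> \<rat>"]) (auto intro!: inj_onI step_set_eqI_rational)
  also have "Pow (\<rat> :: real set) \<lesssim> (UNIV :: nat set set)"
    using countable_rat unfolding lepoll_def
    by (intro exI[of _ "(`) (to_nat_on \<rat>)"]) (auto intro!: inj_on_image_Pow)
  also have "\<dots> \<approx> (UNIV :: real set)"
    by (rule nat_sets_eqpoll_reals)
  finally show ?thesis .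
qed

text \<open>The second condition bounds the density of \<open>D\<close> immediately to the left of \<open>t\<close>, uniformly in the
  scale. It is a family of conditions on the measure of a part of \<open>D\<close>, which is why the sets
  described by it are closed in the measure metric.\<close>

definition small :: "real set \<Rightarrow> real \<Rightarrow> real set \<Rightarrow> bool" where
  "small F e D \<longleftrightarrow> measure lborel D \<le> e \<and>
     (\<forall>t\<in>F. \<forall>s<t. measure lborel (D \<inter> {s..<t}) \<le> e * (t - s))"

lemma small_empty: "0 \<le> e \<Longrightarrow> small F e {}"
  by (simp add: small_def)

lemma small_antimono:
  assumes "small F e D" "F' \<subseteq> F" "e \<le> e'"
  shows "small F' e' D"
  using assms unfolding small_def
  by (smt (verit) mult_right_mono subset_iff)

lemma measure_subadd:
  assumes "D \<in> fmeasurable M" "D' \<in> fmeasurable M" "E \<in> sets M" "E \<subseteq> D \<union> D'"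
  shows "measure M E \<le> measure M D + measure M D'"
  using measure_mono_fmeasurable[OF assms(4,3) fmeasurable.Un[OF assms(1,2)]]
    measure_Un_le[of D M D'] assms(1,2) by (auto simp: fmeasurableD)

lemma small_add:
  assumes "small F e D" "small F e' D'" "D \<in> fmeasurable lborel" "D' \<in> fmeasurable lborel"
    "E \<in> fmeasurable lborel" "E \<subseteq> D \<union> D'"
  shows "small F (e + e') E"
  unfolding small_def
proof (intro conjI ballI allI impI)
  show "measure lborel E \<le> e + e'"
    using measure_subadd[OF assms(3,4) _ assms(6)] assms(1,2,5) by (auto simp: small_def)
  fix s t assume st: "t \<in> F" "s < t"
  have "measure lborel (E \<inter> {s..<t}) \<le> measure lborel (D \<inter> {s..<t}) + measure lborel (D' \<inter> {s..<t})"
    using assms(3-6) by (intro measure_subadd) (auto intro: fmeasurable_Int_fmeasurable)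
  then show "measure lborel (E \<inter> {s..<t}) \<le> (e + e') * (t - s)"
    using assms(1,2) st unfolding small_def distrib_right by force
qed

text \<open>\<open>small_interval\<close> and \<open>small_interval_left\<close> are the two halves of the assertion that the
  Sorgenfrey topology is induced: points slightly to the right are close, those to the left are not.\<close>

lemma small_interval:
  assumes "finite F" "e > 0"
  obtains \<delta> where "\<delta> > 0" "\<And>b. a \<le> b \<Longrightarrow> b < a + \<delta> \<Longrightarrow> small F e {a..<b}"
proof -
  \<comment> \<open>For \<open>t > a\<close> the new interval stays in the left half of \<open>[a,t)\<close>, so an interval \<open>[s,t)\<close> that
    meets it has length at least \<open>(t - a) / 2\<close>; for \<open>t \<le> a\<close> the two are disjoint and any bound does.\<close>
  define \<eta> where "\<eta> t = (if a < t then min ((t - a) / 2) (e * (t - a) / 2) else 1)" for t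
  have \<eta>: "\<eta> t > 0" for t
    using assms(2) by (auto simp: \<eta>_def)
  define \<delta> where "\<delta> = Min (insert e (\<eta> ` F))"
  have "\<delta> > 0" and \<delta>: "\<delta> \<le> e" "\<And>t. t \<in> F \<Longrightarrow> \<delta> \<le> \<eta> t"
    using assms \<eta> by (auto simp: \<delta>_def)
  show thesis
  proof (rule that[OF \<open>\<delta> > 0\<close>])
    fix b assume b: "a \<le> b" "b < a + \<delta>"
    show "small F e {a..<b}"
      unfolding small_def
    proof (intro conjI ballI allI impI)
      show "measure lborel {a..<b} \<le> e"
        using b \<delta> by simp
      fix t s assume t: "t \<in> F" "s < t"
      show "measure lborel ({a..<b} \<inter> {s..<t}) \<le> e * (t - s)"
      proof (cases "a < t \<and> s < b")
        case True
        then have sb: "s < b" by blast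
        from True have "\<delta> \<le> (t - a) / 2" "\<delta> \<le> e * (t - a) / 2"
          using \<delta>(2)[OF t(1)] by (auto simp: \<eta>_def)
        then have "b < a + (t - a) / 2" "b < a + e * (t - a) / 2"
          using b by linarith+
        have "measure lborel ({a..<b} \<inter> {s..<t}) \<le> measure lborel {a..<b}"
          by (intro measure_mono_fmeasurable) (auto simp: fmeasurable_interval)
        also have "\<dots> \<le> e * ((t - a) / 2)"
          using \<open>b < a + e * (t - a) / 2\<close> b by simp
        also have "\<dots> \<le> e * (t - s)"
          using \<open>b < a + (t - a) / 2\<close> sb assms(2) by (intro mult_left_mono) (auto simp: field_simps)
        finally show ?thesis .
      next
        case False
        then have empty: "{a..<b} \<inter> {s..<t} = {}" by auto
        show ?thesis unfolding empty using t assms(2) by simp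
      qed
    qed
  qed
qed

lemma small_interval_left:
  assumes "small {t} e {a..<t}" "e < 1"
  shows "t \<le> a"
proof (rule ccontr)
  assume "\<not> t \<le> a"
  then have "measure lborel ({a..<t} \<inter> {a..<t}) \<le> e * (t - a)"
    using assms(1)[unfolded small_def, THEN conjunct2, rule_format, of t a] by simp
  then have "1 * (t - a) \<le> e * (t - a)"
    using \<open>\<not> t \<le> a\<close> by simp
  then show False
    using \<open>\<not> t \<le> a\<close> assms(2) by (subst (asm) mult_le_cancel_right) auto
qed

text \<open>The map \<open>step_set\<close> is continuous for the Sorgenfrey topology, as the interval between \<open>as ! i\<close>
  and \<open>bs ! i\<close> is small for each \<open>i\<close>.\<close>

lemma step_set_close:
  assumes "finite F" "e > 0" "\<And>i. i < length as \<Longrightarrow> 0 \<le> as ! i"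
  obtains \<delta> where "\<delta> > 0"
    "\<And>bs. length bs = length as \<Longrightarrow> (\<And>i. i < length as \<Longrightarrow> as ! i \<le> bs ! i \<and> bs ! i < as ! i + \<delta>)
       \<Longrightarrow> small F e (sym_diff (step_set as) (step_set bs))"
proof -
  have "\<exists>\<delta>>0. \<forall>bs. length bs = length as \<longrightarrow>
      (\<forall>i<length as. as ! i \<le> bs ! i \<and> bs ! i < as ! i + \<delta>) \<longrightarrow>
      small F e (sym_diff (step_set as) (step_set bs))"
    using assms(2,3)
  proof (induction as arbitrary: e)
    case Nil
    then show ?case by (auto intro!: exI[of _ 1] small_empty)
  next
    case (Cons a as)
    have "0 \<le> a" and nn: "\<And>i. i < length as \<Longrightarrow> 0 \<le> as ! i"
      using Cons.prems(2)[of 0] Cons.prems(2)[of "Suc _"] by auto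
    obtain \<delta> where \<delta>: "\<delta> > 0" "\<forall>bs. length bs = length as \<longrightarrow>
        (\<forall>i<length as. as ! i \<le> bs ! i \<and> bs ! i < as ! i + \<delta>) \<longrightarrow>
        small F (e / 2) (sym_diff (step_set as) (step_set bs))"
      using Cons.IH[of "e / 2"] Cons.prems(1) nn by auto
    obtain \<delta>' where \<delta>': "\<delta>' > 0" "\<And>b. a \<le> b \<Longrightarrow> b < a + \<delta>' \<Longrightarrow> small F (e / 2) {a..<b}"
      using small_interval[OF assms(1), of "e / 2" a] Cons.prems(1) by auto
    show ?case
    proof (intro exI[of _ "min \<delta> \<delta>'"] conjI allI impI)
      show "min \<delta> \<delta>' > 0" using \<delta>(1) \<delta>'(1) by simp
      fix bs assume len: "length bs = length (a # as)" and
        *: "\<forall>i<length (a # as). (a # as) ! i \<le> bs ! i \<and> bs ! i < (a # as) ! i + min \<delta> \<delta>'"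
      then obtain b bs' where bs: "bs = b # bs'" by (cases bs) auto
      have "small F (e / 2) {a..<b}"
        using *[rule_format, of 0] by (intro \<delta>'(2)) (auto simp: bs)
      moreover have "small F (e / 2) (sym_diff (step_set as) (step_set bs'))"
      proof (intro \<delta>(2)[rule_format])
        show "length bs' = length as" using len by (simp add: bs)
        fix i assume "i < length as"
        then show "as ! i \<le> bs' ! i \<and> bs' ! i < as ! i + \<delta>"
          using *[rule_format, of "Suc i"] by (auto simp: bs)
      qed
      ultimately have "small F (e / 2 + e / 2) (sym_diff (step_set (a # as)) (step_set bs))"
      proof (rule small_add)
        show "sym_diff (step_set as) (step_set bs') \<in> fmeasurable lborel"
          using step_set_fmeasurable[of "as @ bs'"] by (simp only: step_set_append)
        show "sym_diff (step_set (a # as)) (step_set bs) \<in> fmeasurable lborel"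
          using step_set_fmeasurable[of "(a # as) @ bs"] by (simp only: step_set_append)
        show "sym_diff (step_set (a # as)) (step_set bs) \<subseteq>
            {a..<b} \<union> sym_diff (step_set as) (step_set bs')"
          using *[rule_format, of 0] \<open>0 \<le> a\<close> by (auto simp: bs)
      qed (rule fmeasurable_interval)
      then show "small F e (sym_diff (step_set (a # as)) (step_set bs))"
        by simp
    qed
  qed
  then show thesis using that by blast
qed

section \<open>The group of step sets and its topology\<close>

text \<open>The group lives on an arbitrary set \<open>K\<close> of codes for the step sets with ends in \<open>A\<close>, so that it can
  be realised on any sufficiently large type.\<close>

locale step_group =
  fixes A :: "real set" and K :: "'g set" and \<sigma> :: "'g \<Rightarrow> real set"
  assumes positive: "\<And>a. a \<in> A \<Longrightarrow> a > 0"
    and bij: "bij_betw \<sigma> K (step_set ` lists A)"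
begin

abbreviation diff :: "'g \<Rightarrow> 'g \<Rightarrow> real set" where
  "diff x y \<equiv> sym_diff (\<sigma> x) (\<sigma> y)"

definition elt :: "real list \<Rightarrow> 'g" where
  "elt as = inv_into K \<sigma> (step_set as)"

lemma elt:
  assumes "as \<in> lists A"
  shows "elt as \<in> K" "\<sigma> (elt as) = step_set as"
  using assms bij_betw_imp_surj_on[OF bij] unfolding elt_def
  by (metis imageI inv_into_into, metis imageI f_inv_into_f)

lemma elt_cases:
  assumes "x \<in> K" obtains as where "as \<in> lists A" "x = elt as"
proof -
  obtain as where "as \<in> lists A" "\<sigma> x = step_set as"
    using assms bij_betw_imp_surj_on[OF bij] by blast
  then show thesis
    using that bij assms by (metis elt_def bij_betw_def inv_into_f_f)
qed

lemma \<sigma>_inject: "x \<in> K \<Longrightarrow> y \<in> K \<Longrightarrow> \<sigma> x = \<sigma> y \<Longrightarrow> x = y"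
  using bij by (metis bij_betw_def inj_onD)

lemma \<sigma>_fmeasurable: "x \<in> K \<Longrightarrow> \<sigma> x \<in> fmeasurable lborel"
  by (metis elt_cases elt(2) step_set_fmeasurable)

lemma diff_fmeasurable: "x \<in> K \<Longrightarrow> y \<in> K \<Longrightarrow> diff x y \<in> fmeasurable lborel"
  by (intro fmeasurable.Un fmeasurable.Diff \<sigma>_fmeasurable)

definition grp :: "'g monoid" where
  "grp = \<lparr>carrier = K, mult = (\<lambda>x y. inv_into K \<sigma> (diff x y)), one = elt []\<rparr>"

lemma mult:
  assumes "x \<in> K" "y \<in> K"
  shows "x \<otimes>\<^bsub>grp\<^esub> y \<in> K" "\<sigma> (x \<otimes>\<^bsub>grp\<^esub> y) = diff x y"
proof -
  obtain as bs where *: "as \<in> lists A" "x = elt as" "bs \<in> lists A" "y = elt bs"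
    using assms elt_cases by metis
  then have "x \<otimes>\<^bsub>grp\<^esub> y = elt (as @ bs)"
    by (simp add: grp_def elt_def[of "as @ bs"] step_set_append elt)
  then show "x \<otimes>\<^bsub>grp\<^esub> y \<in> K" "\<sigma> (x \<otimes>\<^bsub>grp\<^esub> y) = diff x y"
    using * elt[of "as @ bs"] by (auto simp: step_set_append elt)
qed

lemma grp_carrier: "carrier grp = K"
  by (simp add: grp_def)

lemma one: "\<one>\<^bsub>grp\<^esub> \<in> K" "\<sigma> \<one>\<^bsub>grp\<^esub> = {}"
  using elt[of "[]"] by (simp_all add: grp_def)

lemma group_grp: "group grp"
proof (rule groupI; unfold grp_carrier)
  show "\<exists>y\<in>K. y \<otimes>\<^bsub>grp\<^esub> x = \<one>\<^bsub>grp\<^esub>" if "x \<in> K" for x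
    using that by (intro bexI[of _ x] \<sigma>_inject) (auto simp: mult one)
qed (auto intro!: \<sigma>_inject simp: mult one)

lemma inv_grp:
  assumes "x \<in> K" shows "inv\<^bsub>grp\<^esub> x = x"
proof -
  interpret group grp by (rule group_grp)
  have "x \<otimes>\<^bsub>grp\<^esub> x = \<one>\<^bsub>grp\<^esub>"
    using assms by (intro \<sigma>_inject) (auto simp: mult one)
  then show ?thesis
    using assms by (intro inv_equality) (auto simp: grp_carrier)
qed

definition gtop :: "'g topology" where
  "gtop = topology (\<lambda>U. U \<subseteq> K \<and>
     (\<forall>x\<in>U. \<exists>F e. finite F \<and> e > 0 \<and> (\<forall>y\<in>K. small F e (diff x y) \<longrightarrow> y \<in> U)))"

lemma openin_gtop:
  "openin gtop U \<longleftrightarrow> U \<subseteq> K \<and>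
     (\<forall>x\<in>U. \<exists>F e. finite F \<and> e > 0 \<and> (\<forall>y\<in>K. small F e (diff x y) \<longrightarrow> y \<in> U))"
proof -
  have "istopology (\<lambda>U. U \<subseteq> K \<and>
     (\<forall>x\<in>U. \<exists>F e. finite F \<and> e > 0 \<and> (\<forall>y\<in>K. small F e (diff x y) \<longrightarrow> y \<in> U)))"
    unfolding istopology_def
  proof (intro conjI allI impI ballI; (elim conjE)?)
    fix S T x
    assume S: "\<forall>x\<in>S. \<exists>F e. finite F \<and> e > 0 \<and> (\<forall>y\<in>K. small F e (diff x y) \<longrightarrow> y \<in> S)"
      and T: "\<forall>x\<in>T. \<exists>F e. finite F \<and> e > 0 \<and> (\<forall>y\<in>K. small F e (diff x y) \<longrightarrow> y \<in> T)"
      and x: "x \<in> S \<inter> T"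
    obtain F e where 1: "finite F" "e > 0" "\<forall>y\<in>K. small F e (diff x y) \<longrightarrow> y \<in> S"
      using S x by blast
    obtain F' e' where 2: "finite F'" "e' > 0" "\<forall>y\<in>K. small F' e' (diff x y) \<longrightarrow> y \<in> T"
      using T x by blast
    have "\<forall>y\<in>K. small (F \<union> F') (min e e') (diff x y) \<longrightarrow> y \<in> S \<inter> T"
      using 1(3) 2(3) by (blast intro: small_antimono min.cobounded1 min.cobounded2)
    then show "\<exists>F e. finite F \<and> e > 0 \<and> (\<forall>y\<in>K. small F e (diff x y) \<longrightarrow> y \<in> S \<inter> T)"
      using 1 2 by (intro exI[of _ "F \<union> F'"] exI[of _ "min e e'"]) simp
  next
    fix \<U> x
    assume "\<forall>S\<in>\<U>. S \<subseteq> K \<and>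
        (\<forall>x\<in>S. \<exists>F e. finite F \<and> e > 0 \<and> (\<forall>y\<in>K. small F e (diff x y) \<longrightarrow> y \<in> S))"
      and "x \<in> \<Union>\<U>"
    then show "\<exists>F e. finite F \<and> e > 0 \<and> (\<forall>y\<in>K. small F e (diff x y) \<longrightarrow> y \<in> \<Union>\<U>)"
      by (meson UnionE UnionI)
  qed auto
  then show ?thesis
    by (simp add: gtop_def topology_inverse')
qed

lemma topspace_gtop: "topspace gtop = K"
proof
  show "topspace gtop \<subseteq> K"
    using openin_gtop openin_topspace by blast
  have "openin gtop K"
    unfolding openin_gtop by (auto intro!: exI[of _ "{}"] exI[of _ 1])
  then show "K \<subseteq> topspace gtop" by (rule openin_subset)
qed

lemma diff_triangle:
  assumes "x \<in> K" "y \<in> K" "z \<in> K" "small F e (diff x y)" "small F e' (diff y z)"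
  shows "small F (e + e') (diff x z)"
  using assms by (intro small_add[OF assms(4,5)] diff_fmeasurable) auto

text \<open>The set \<open>{y\<in>K. small F e (diff x y)}\<close> itself need not be open, but the points for which some
  \<open>e' < e\<close> will do form an open subset.\<close>

lemma ball_nbhd:
  assumes "x \<in> K" "finite F" "e > 0"
  obtains U where "openin gtop U" "x \<in> U" "U \<subseteq> {y\<in>K. small F e (diff x y)}"
proof
  let ?U = "{y\<in>K. \<exists>e'<e. small F e' (diff x y)}"
  show "x \<in> ?U"
    using assms by (auto intro!: exI[of _ 0] small_empty)
  show "?U \<subseteq> {y\<in>K. small F e (diff x y)}"
    by (auto intro: small_antimono less_imp_le)
  show "openin gtop ?U"
    unfolding openin_gtop
  proof (intro conjI ballI)
    fix y assume "y \<in> ?U"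
    then obtain e' where y: "y \<in> K" "e' < e" "small F e' (diff x y)" by blast
    have "\<forall>z\<in>K. small F ((e - e') / 2) (diff y z) \<longrightarrow> z \<in> ?U"
    proof (intro ballI impI)
      fix z assume z: "z \<in> K" "small F ((e - e') / 2) (diff y z)"
      then have "small F (e' + (e - e') / 2) (diff x z)"
        using assms(1) y diff_triangle by blast
      moreover have "e' + (e - e') / 2 < e" using y(2) by (simp add: field_simps)
      ultimately show "z \<in> ?U" using z(1) by blast
    qed
    then show "\<exists>F e. finite F \<and> e > 0 \<and> (\<forall>z\<in>K. small F e (diff y z) \<longrightarrow> z \<in> ?U)"
      using assms(2) y(2) by (intro exI[of _ F] exI[of _ "(e - e') / 2"]) simp
  qed blast
qed

lemma topological_group_gtop: "topological_group grp gtop"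
  unfolding topological_group_def
proof (intro conjI)
  show "group grp" by (rule group_grp)
  show "topspace gtop = carrier grp" by (simp add: topspace_gtop grp_carrier)
  show "continuous_map gtop gtop (\<lambda>x. inv\<^bsub>grp\<^esub> x)"
    by (rule continuous_map_eq[OF continuous_map_id]) (simp add: topspace_gtop inv_grp)
  show "continuous_map (prod_topology gtop gtop) gtop (\<lambda>(x, y). x \<otimes>\<^bsub>grp\<^esub> y)"
    unfolding continuous_map_def
  proof (intro conjI allI impI)
    show "(\<lambda>(x, y). x \<otimes>\<^bsub>grp\<^esub> y) \<in> topspace (prod_topology gtop gtop) \<rightarrow> topspace gtop"
      by (auto simp: topspace_gtop mult)
    fix W assume W: "openin gtop W"
    show "openin (prod_topology gtop gtop)
        {p \<in> topspace (prod_topology gtop gtop). (case p of (x, y) \<Rightarrow> x \<otimes>\<^bsub>grp\<^esub> y) \<in> W}"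
      unfolding openin_prod_topology_alt
    proof (intro allI impI)
      fix x y
      assume "(x, y) \<in> {p \<in> topspace (prod_topology gtop gtop). (case p of (x, y) \<Rightarrow> x \<otimes>\<^bsub>grp\<^esub> y) \<in> W}"
      then have xy: "x \<in> K" "y \<in> K" "x \<otimes>\<^bsub>grp\<^esub> y \<in> W"
        by (auto simp: topspace_gtop)
      obtain F e where F: "finite F" "e > 0"
          "\<And>z. z \<in> K \<Longrightarrow> small F e (diff (x \<otimes>\<^bsub>grp\<^esub> y) z) \<Longrightarrow> z \<in> W"
        using W xy(3) unfolding openin_gtop by blast
      obtain U where U: "openin gtop U" "x \<in> U" "U \<subseteq> {z\<in>K. small F (e/2) (diff x z)}"
        using ball_nbhd[OF xy(1) F(1)] F(2) half_gt_zero by blast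
      obtain V where V: "openin gtop V" "y \<in> V" "V \<subseteq> {z\<in>K. small F (e/2) (diff y z)}"
        using ball_nbhd[OF xy(2) F(1)] F(2) half_gt_zero by blast
      have "u \<otimes>\<^bsub>grp\<^esub> v \<in> W" if "u \<in> U" "v \<in> V" for u v
      proof (rule F(3))
        have uv: "u \<in> K" "v \<in> K" "small F (e/2) (diff x u)" "small F (e/2) (diff y v)"
          using that U(3) V(3) by auto
        then show "u \<otimes>\<^bsub>grp\<^esub> v \<in> K" by (simp add: mult)
        have "small F (e/2 + e/2) (diff (x \<otimes>\<^bsub>grp\<^esub> y) (u \<otimes>\<^bsub>grp\<^esub> v))"
          using uv xy by (intro small_add[OF uv(3,4)] diff_fmeasurable) (auto simp: mult)
        then show "small F e (diff (x \<otimes>\<^bsub>grp\<^esub> y) (u \<otimes>\<^bsub>grp\<^esub> v))" by simp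
      qed
      then show "\<exists>U V. openin gtop U \<and> openin gtop V \<and> x \<in> U \<and> y \<in> V \<and>
          U \<times> V \<subseteq> {p \<in> topspace (prod_topology gtop gtop). (case p of (x, y) \<Rightarrow> x \<otimes>\<^bsub>grp\<^esub> y) \<in> W}"
        using U V by (intro exI[of _ U] exI[of _ V]) (auto simp: topspace_gtop)
    qed
  qed
qed

text \<open>The coarser metric is the measure of the symmetric difference.\<close>

lemma cometrizable_gtop: "cometrizable gtop"
proof -
  define d where "d x y = measure lborel (diff x y)" for x y
  have tri: "d x z \<le> d x y + d y z" if "x \<in> K" "y \<in> K" "z \<in> K" for x y z
    unfolding d_def using that
    by (intro measure_subadd diff_fmeasurable fmeasurableD) auto
  interpret d: Metric_space K d
  proof
    show "d x y = 0 \<longleftrightarrow> x = y" if xy: "x \<in> K" "y \<in> K" for x y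
    proof
      assume "d x y = 0"
      moreover obtain as bs where "\<sigma> x = step_set as" "\<sigma> y = step_set bs"
        using xy elt_cases elt(2) by metis
      ultimately show "x = y"
        using \<sigma>_inject[OF xy] step_set_eqI_measure[of as bs] by (auto simp: d_def)
    qed (simp add: d_def)
  qed (auto simp: d_def Un_commute intro: tri[unfolded d_def])
  show ?thesis
    unfolding cometrizable_def
  proof (intro exI[of _ d.mtopology] conjI allI impI)
    show "metrizable_space d.mtopology" by (rule d.metrizable_space_mtopology)
    show "topspace d.mtopology = topspace gtop" by (simp add: topspace_gtop)
    show "openin gtop U" if "openin d.mtopology U" for U
      unfolding openin_gtop
    proof (intro conjI ballI)
      show "U \<subseteq> K" using openin_subset[OF that] by simp
      fix x assume "x \<in> U"
      then have "\<exists>e>0. d.mball x e \<subseteq> U"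
        using that by (simp add: d.openin_mtopology)
      then obtain e where e: "e > 0" "d.mball x e \<subseteq> U"
        by blast
      have "\<forall>y\<in>K. small {} (e/2) (diff x y) \<longrightarrow> y \<in> U"
        using e \<open>x \<in> U\<close> \<open>U \<subseteq> K\<close> by (force simp: small_def d_def[symmetric])
      then show "\<exists>F e. finite F \<and> e > 0 \<and> (\<forall>y\<in>K. small F e (diff x y) \<longrightarrow> y \<in> U)"
        using e(1) by (intro exI[of _ "{}"] exI[of _ "e/2"]) simp
    qed
    have closed: "closedin d.mtopology {y\<in>K. small F e (diff x y)}" if "x \<in> K" for x F e
    proof -
      \<comment> \<open>the measure of \<open>diff x y \<inter> B\<close> is 1-Lipschitz in \<open>y\<close>\<close>
      have 1: "closedin d.mtopology {y\<in>K. measure lborel (diff x y \<inter> B) \<le> m}"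
        if "B \<in> sets lborel" for B m
      proof (unfold d.closedin_metric, intro conjI allI impI)
        fix y assume "y \<in> K - {y\<in>K. measure lborel (diff x y \<inter> B) \<le> m}"
        then have y: "y \<in> K" "measure lborel (diff x y \<inter> B) > m" by auto
        have "disjnt {y\<in>K. measure lborel (diff x y \<inter> B) \<le> m}
            (d.mball y (measure lborel (diff x y \<inter> B) - m))"
        proof (unfold disjnt_iff, intro allI notI, elim conjE)
          fix z assume "z \<in> {y\<in>K. measure lborel (diff x y \<inter> B) \<le> m}"
            and "z \<in> d.mball y (measure lborel (diff x y \<inter> B) - m)"
          then have z: "z \<in> K" "measure lborel (diff x z \<inter> B) \<le> m"
              "d y z < measure lborel (diff x y \<inter> B) - m" by auto
          have "measure lborel (diff x y \<inter> B) \<le> measure lborel (diff x z \<inter> B) + d y z"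
            unfolding d_def using \<open>x \<in> K\<close> y(1) z(1) that diff_fmeasurable
            by (intro measure_subadd) (auto intro!: fmeasurable_Int_fmeasurable dest: fmeasurableD)
          then show False using z by simp
        qed
        then show "\<exists>r>0. disjnt {y\<in>K. measure lborel (diff x y \<inter> B) \<le> m} (d.mball y r)"
          using y(2) by (intro exI[of _ "measure lborel (diff x y \<inter> B) - m"]) simp
      qed auto
      have "closedin d.mtopology {y\<in>K. measure lborel (diff x y) \<le> e}"
        using 1[of UNIV e] by simp
      moreover have eq: "{y\<in>K. small F e (diff x y)} =
        \<Inter> (insert {y\<in>K. measure lborel (diff x y) \<le> e}
          ((\<lambda>(t, s). {y\<in>K. measure lborel (diff x y \<inter> {s..<t}) \<le> e * (t - s)}) `
            {(t, s). t \<in> F \<and> s < t}))"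
        by (auto simp: small_def)
      ultimately show ?thesis
        unfolding eq by (intro closedin_Inter) (auto intro!: 1)
    qed
    show "neighbourhood_base_of (closedin d.mtopology) gtop"
      unfolding neighbourhood_base_of
    proof (intro allI impI, elim conjE)
      fix W x assume W: "openin gtop W" "x \<in> W"
      then have "x \<in> K" using openin_gtop by blast
      obtain F e where F: "finite F" "e > 0" "\<forall>y\<in>K. small F e (diff x y) \<longrightarrow> y \<in> W"
        using W unfolding openin_gtop by blast
      obtain U where U: "openin gtop U" "x \<in> U" "U \<subseteq> {y\<in>K. small F e (diff x y)}"
        using ball_nbhd[OF \<open>x \<in> K\<close> F(1,2)] .
      have "{y\<in>K. small F e (diff x y)} \<subseteq> W"
        using F(3) by (auto simp only: mem_Collect_eq)
      with U closed[OF \<open>x \<in> K\<close>]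
      show "\<exists>U V. openin gtop U \<and> closedin d.mtopology V \<and> x \<in> U \<and> U \<subseteq> V \<and> V \<subseteq> W"
        by (intro exI[of _ U] exI[of _ "{y\<in>K. small F e (diff x y)}"] conjI)
    qed
  qed
qed

end

section \<open>The countable power is hereditarily Lindelof\<close>

context step_group
begin

lemma small_ball_in_power:
  assumes "openin (product_topology (\<lambda>_ :: nat. gtop) UNIV) U" "y \<in> U"
  obtains n F e where "finite F" "e > 0"
    "\<And>z. (\<And>i. z i \<in> K) \<Longrightarrow> (\<And>i. i < n \<Longrightarrow> small F e (diff (y i) (z i))) \<Longrightarrow> z \<in> U"
proof -
  obtain V where V: "finite {i. V i \<noteq> K}" "\<And>i. openin gtop (V i)" "y \<in> Pi\<^sub>E UNIV V"
      "Pi\<^sub>E UNIV V \<subseteq> U"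
    using bspec[OF assms(1)[unfolded openin_product_topology_alt topspace_gtop] assms(2)] by auto
  have yV: "y i \<in> V i" for i
    using V(3) by auto
  obtain n where n: "\<And>i. V i \<noteq> K \<Longrightarrow> i < n"
    using V(1) by (auto simp: finite_nat_iff_bounded)
  have "\<exists>F e. finite F \<and> e > 0 \<and> (\<forall>z\<in>K. small F e (diff (y i) z) \<longrightarrow> z \<in> V i)" for i
    using V(2)[of i] yV[of i] unfolding openin_gtop by blast
  then obtain F e where F: "\<And>i. finite (F i)" "\<And>i. e i > 0"
      "\<And>i z. z \<in> K \<Longrightarrow> small (F i) (e i) (diff (y i) z) \<Longrightarrow> z \<in> V i"
    by metis
  let ?e = "Min (insert 1 (e ` {..<n}))"
  show thesis
  proof (rule that[of "\<Union>i<n. F i" ?e n])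
    fix z assume z: "\<And>i. z i \<in> K" "\<And>i. i < n \<Longrightarrow> small (\<Union>i<n. F i) ?e (diff (y i) (z i))"
    have "z i \<in> V i" for i
    proof (cases "i < n")
      case True
      have "small (F i) (e i) (diff (y i) (z i))"
        using z(2)[OF True] by (rule small_antimono) (use True in auto)
      then show ?thesis using F(3) z(1) by blast
    next
      case False
      then show ?thesis using n z(1) by blast
    qed
    then show "z \<in> U" using V(4) by auto
  qed (use F in auto)
qed

text \<open>Each point \<open>y\<close> is given lists \<open>as y i\<close> for the finitely many coordinates \<open>i < n y\<close> that matter for
  its neighbourhood. There are countably many patterns of lengths of these lists. For points with the
  same pattern the lists are concatenated to a finite tuple over \<open>A\<close>, whose entry with index
  \<open>prod_encode (i, j)\<close> is \<open>as y i ! j\<close>, and \<open>countable_Sorgenfrey_cover\<close> applies.\<close>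

lemma hereditarily_Lindelof_power:
  assumes A: "countably_dominated A"
  shows "hereditarily_Lindelof (product_topology (\<lambda>_ :: nat. gtop) UNIV)"
  unfolding hereditarily_Lindelof_def
proof (intro allI impI)
  let ?P = "product_topology (\<lambda>_ :: nat. gtop) UNIV"
  fix S assume S: "S \<subseteq> topspace ?P"
  show "Lindelof_space (subtopology ?P S)"
    unfolding Lindelof_space_subtopology_subset[OF S]
  proof (intro allI impI, elim conjE)
    fix \<U> assume \<U>: "\<forall>U\<in>\<U>. openin ?P U" "S \<subseteq> \<Union>\<U>"
    have SK: "y i \<in> K" if "y \<in> S" for y i
      using subsetD[OF S that] by (auto simp: topspace_gtop)
    have "\<exists>U\<in>\<U>. y \<in> U" if "y \<in> S" for y
      using \<U>(2) that by blast
    then obtain U where U: "\<And>y. y \<in> S \<Longrightarrow> U y \<in> \<U>" "\<And>y. y \<in> S \<Longrightarrow> y \<in> U y"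
      by metis
    have "\<exists>n F e. finite F \<and> e > 0 \<and> (\<forall>z. (\<forall>i. z i \<in> K) \<longrightarrow> (\<forall>i<n. small F e (diff (y i) (z i))) \<longrightarrow> z \<in> U y)"
      if "y \<in> S" for y
      using small_ball_in_power[of "U y" y] \<U>(1) U that by metis
    then obtain n F e where F: "\<And>y. y \<in> S \<Longrightarrow> finite (F y)" "\<And>y. y \<in> S \<Longrightarrow> e y > 0"
        "\<And>y z. y \<in> S \<Longrightarrow> (\<forall>i. z i \<in> K) \<Longrightarrow> (\<forall>i<n y. small (F y) (e y) (diff (y i) (z i))) \<Longrightarrow> z \<in> U y"
      by metis
    have "\<exists>as. as \<in> lists A \<and> y i = elt as" if "y \<in> S" for y i
      using SK[OF that] elt_cases by metis
    then obtain as where as: "\<And>y i. y \<in> S \<Longrightarrow> as y i \<in> lists A" "\<And>y i. y \<in> S \<Longrightarrow> y i = elt (as y i)"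
      by metis
    have "\<exists>\<delta>>0. \<forall>bs. length bs = length (as y i) \<longrightarrow>
        (\<forall>j<length (as y i). as y i ! j \<le> bs ! j \<and> bs ! j < as y i ! j + \<delta>) \<longrightarrow>
        small (F y) (e y) (sym_diff (step_set (as y i)) (step_set bs))" if y: "y \<in> S" for y i
    proof -
      have "0 \<le> as y i ! j" if "j < length (as y i)" for j
        using as(1)[OF y, of i] that positive by (metis in_listsD less_imp_le nth_mem)
      then show ?thesis
        using step_set_close[OF F(1,2)[OF y], of "as y i"] by metis
    qed
    then obtain \<delta> where \<delta>: "\<And>y i. y \<in> S \<Longrightarrow> \<delta> y i > 0"
      "\<And>y i bs. y \<in> S \<Longrightarrow> length bs = length (as y i) \<Longrightarrow>
        (\<forall>j<length (as y i). as y i ! j \<le> bs ! j \<and> bs ! j < as y i ! j + \<delta> y i) \<Longrightarrow>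
        small (F y) (e y) (sym_diff (step_set (as y i)) (step_set bs))"
      by metis
    define \<delta>' where "\<delta>' y = Min (insert 1 (\<delta> y ` {..<n y}))" for y
    have \<delta>': "\<delta>' y > 0" "\<And>i. i < n y \<Longrightarrow> \<delta>' y \<le> \<delta> y i" if "y \<in> S" for y
      using \<delta>(1)[OF that] by (auto simp: \<delta>'_def)
    define shape where "shape y = map (\<lambda>i. length (as y i)) [0..<n y]" for y
    define x where "x y k = (case prod_decode k of (i, j) \<Rightarrow> as y i ! j)" for y k
    define I where "I p = prod_encode ` (SIGMA i:{..<length p}. {..<p ! i})" for p :: "nat list"
    define covers where "covers p C \<longleftrightarrow> C \<subseteq> {y\<in>S. shape y = p} \<and> countable C \<and>
      (\<forall>s\<in>{y\<in>S. shape y = p}. \<exists>t\<in>C. \<forall>i\<in>I p. x t i \<le> x s i \<and> x s i < x t i + \<delta>' t)" for p C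
    have "\<exists>C. covers p C" for p
      unfolding covers_def
    proof (rule countable_Sorgenfrey_cover[OF A])
      show "finite (I p)" by (simp add: I_def)
      show "x y k \<in> A" if y: "y \<in> {y\<in>S. shape y = p}" and k: "k \<in> I p" for y k
      proof -
        obtain i j where ij: "i < length p" "j < p ! i" "k = prod_encode (i, j)"
          using k by (auto simp: I_def)
        then have "j < length (as y i)"
          using y by (auto simp: shape_def)
        then have "as y i ! j \<in> A"
          using as(1)[of y i] y by auto
        then show ?thesis by (simp add: x_def ij(3))
      qed
    qed (use \<delta>'(1) in auto)
    then obtain C where C: "\<And>p. covers p (C p)"
      by metis
    note C = C[unfolded covers_def, THEN conjunct1]
      C[unfolded covers_def, THEN conjunct2, THEN conjunct1]
      C[unfolded covers_def, THEN conjunct2, THEN conjunct2]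
    show "\<exists>\<V>. countable \<V> \<and> \<V> \<subseteq> \<U> \<and> S \<subseteq> \<Union>\<V>"
    proof (intro exI[of _ "U ` (\<Union>p. C p)"] conjI subsetI)
      show "countable (U ` (\<Union>p. C p))"
        using C(2) by blast
      show "V \<in> \<U>" if "V \<in> U ` (\<Union>p. C p)" for V
        using that C(1) U(1) by blast
      fix y assume y: "y \<in> S"
      obtain t where t: "t \<in> C (shape y)"
          "\<forall>k\<in>I (shape y). x t k \<le> x y k \<and> x y k < x t k + \<delta>' t"
        using C(3)[of "shape y"] y by blast
      have "t \<in> S" and shape: "shape t = shape y"
        using t(1) C(1) by blast+
      have n: "n t = n y"
        using arg_cong[OF shape, of length] by (simp add: shape_def)
      have "y \<in> U t"
      proof (rule F(3)[OF \<open>t \<in> S\<close>]; intro allI impI)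
        show "y i \<in> K" for i using SK y by blast
        fix i assume i: "i < n t"
        have len: "length (as y i) = length (as t i)"
          using shape i n by (simp add: shape_def)
        have "as t i ! j \<le> as y i ! j \<and> as y i ! j < as t i ! j + \<delta> t i" if "j < length (as t i)" for j
        proof -
          have "prod_encode (i, j) \<in> I (shape y)"
            using i n that len by (auto simp: I_def shape_def)
          then have "as t i ! j \<le> as y i ! j \<and> as y i ! j < as t i ! j + \<delta>' t"
            using t(2) by (auto simp: x_def dest!: bspec[of _ _ "prod_encode (i, j)"])
          then show ?thesis
            using \<delta>'(2)[OF \<open>t \<in> S\<close> i] by linarith
        qed
        then have "small (F t) (e t) (sym_diff (step_set (as t i)) (step_set (as y i)))"
          using len by (intro \<delta>(2)[OF \<open>t \<in> S\<close>]) auto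
        then show "small (F t) (e t) (diff (t i) (y i))"
          using as[OF \<open>t \<in> S\<close>, of i] as[OF y, of i] by (simp add: elt(2))
      qed
      then show "y \<in> \<Union> (U ` (\<Union>p. C p))"
        using t(1) by blast
    qed
  qed
qed

end

section \<open>The Sorgenfrey line in the group\<close>

lemma openin_sorgenfrey_line_Ico: "openin sorgenfrey_line {a..<b}"
proof (cases "a < b")
  case True
  then show ?thesis
    unfolding sorgenfrey_line_def by (intro topology_generated_by_Basis) blast
qed simp

lemma openin_sorgenfrey_line:
  "openin sorgenfrey_line U \<longleftrightarrow> (\<forall>x\<in>U. \<exists>\<delta>>0. {x..<x + \<delta>} \<subseteq> U)"
proof
  assume "openin sorgenfrey_line U"
  then have "generate_topology_on {{a..<b} | a b :: real. a < b} U"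
    unfolding sorgenfrey_line_def by (simp add: openin_topology_generated_by_iff)
  then show "\<forall>x\<in>U. \<exists>\<delta>>0. {x..<x + \<delta>} \<subseteq> U"
  proof induction
    case (Int S T)
    show ?case
    proof
      fix x assume "x \<in> S \<inter> T"
      then obtain \<delta> \<delta>' where "\<delta> > 0" "{x..<x + \<delta>} \<subseteq> S" "\<delta>' > 0" "{x..<x + \<delta>'} \<subseteq> T"
        using Int.IH by blast
      moreover have "{x..<x + min \<delta> \<delta>'} \<subseteq> {x..<x + \<delta>} \<inter> {x..<x + \<delta>'}"
        by (auto simp: min_def split: if_splits)
      ultimately show "\<exists>\<delta>>0. {x..<x + \<delta>} \<subseteq> S \<inter> T"
        by (intro exI[of _ "min \<delta> \<delta>'"] conjI) (simp, blast)
    qed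
  next
    case (UN \<U>)
    then show ?case by (meson Union_iff Sup_upper order_trans)
  next
    case (Basis s)
    then obtain a b where s: "s = {a..<b}" by blast
    show ?case
    proof
      fix x assume "x \<in> s"
      then show "\<exists>\<delta>>0. {x..<x + \<delta>} \<subseteq> s"
        unfolding s by (intro exI[of _ "b - x"]) auto
    qed
  qed simp
next
  assume U: "\<forall>x\<in>U. \<exists>\<delta>>0. {x..<x + \<delta>} \<subseteq> U"
  show "openin sorgenfrey_line U"
  proof (subst openin_subopen, intro ballI)
    fix x assume "x \<in> U"
    then obtain \<delta> where "\<delta> > 0" "{x..<x + \<delta>} \<subseteq> U" using U by blast
    then show "\<exists>T. openin sorgenfrey_line T \<and> x \<in> T \<and> T \<subseteq> U"
      by (intro exI[of _ "{x..<x + \<delta>}"]) (auto simp: openin_sorgenfrey_line_Ico)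
  qed
qed

lemma topspace_sorgenfrey_line: "topspace sorgenfrey_line = UNIV"
proof -
  have "openin sorgenfrey_line UNIV"
    unfolding openin_sorgenfrey_line by (auto intro: exI[of _ 1])
  then show ?thesis using openin_subset by blast
qed

context step_group
begin

lemma Sorgenfrey_embedding:
  "homeomorphic_map (subtopology sorgenfrey_line A) (subtopology gtop ((\<lambda>a. elt [a]) ` A)) (\<lambda>a. elt [a])"
proof -
  let ?f = "\<lambda>a. elt [a]"
  have f: "?f a \<in> K" "\<sigma> (?f a) = {0..<a}" if "a \<in> A" for a
    using that elt[of "[a]"] by auto
  have diff: "diff (?f a) (?f b) = {a..<b}" "diff (?f b) (?f a) = {a..<b}"
    if "a \<in> A" "b \<in> A" "a \<le> b" for a b
    using that positive[of a] by (auto simp: f)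
  show ?thesis
  proof (rule bijective_open_imp_homeomorphic_map)
    show "continuous_map (subtopology sorgenfrey_line A) (subtopology gtop (?f ` A)) ?f"
      unfolding continuous_map_in_subtopology
    proof
      show "continuous_map (subtopology sorgenfrey_line A) gtop ?f"
        unfolding continuous_map_def
      proof (intro conjI allI impI)
        show "?f \<in> topspace (subtopology sorgenfrey_line A) \<rightarrow> topspace gtop"
          using f by (auto simp: topspace_gtop)
        fix W assume W: "openin gtop W"
        show "openin (subtopology sorgenfrey_line A) {a \<in> topspace (subtopology sorgenfrey_line A). ?f a \<in> W}"
        proof (subst openin_subopen, intro ballI)
          fix a assume "a \<in> {a \<in> topspace (subtopology sorgenfrey_line A). ?f a \<in> W}"
          then have a: "a \<in> A" "?f a \<in> W" by auto
          obtain F e where F: "finite F" "e > 0" "\<And>y. y \<in> K \<Longrightarrow> small F e (diff (?f a) y) \<Longrightarrow> y \<in> W"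
            using W a(2) unfolding openin_gtop by blast
          obtain \<delta> where \<delta>: "\<delta> > 0" "\<And>b. a \<le> b \<Longrightarrow> b < a + \<delta> \<Longrightarrow> small F e {a..<b}"
            using small_interval[OF F(1,2)] by blast
          have "openin (subtopology sorgenfrey_line A) ({a..<a + \<delta>} \<inter> A)"
            using openin_sorgenfrey_line_Ico by (auto simp: openin_subtopology)
          moreover have "?f b \<in> W" if "b \<in> {a..<a + \<delta>} \<inter> A" for b
            using that a(1) \<delta>(2)[of b] by (intro F(3)) (simp_all add: f(1) diff(1))
          ultimately show "\<exists>T. openin (subtopology sorgenfrey_line A) T \<and> a \<in> T \<and>
              T \<subseteq> {a \<in> topspace (subtopology sorgenfrey_line A). ?f a \<in> W}"
            using a \<delta>(1) by (intro exI[of _ "{a..<a + \<delta>} \<inter> A"]) (auto simp: topspace_sorgenfrey_line)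
        qed
      qed
    qed (auto simp: topspace_sorgenfrey_line)
    show "open_map (subtopology sorgenfrey_line A) (subtopology gtop (?f ` A)) ?f"
      unfolding open_map_def
    proof (intro allI impI)
      fix U assume "openin (subtopology sorgenfrey_line A) U"
      then obtain V where V: "openin sorgenfrey_line V" "U = V \<inter> A"
        by (auto simp: openin_subtopology)
      show "openin (subtopology gtop (?f ` A)) (?f ` U)"
      proof (subst openin_subopen, intro ballI)
        fix x assume "x \<in> ?f ` U"
        then obtain a where a: "x = ?f a" "a \<in> V" "a \<in> A"
          using V(2) by blast
        obtain \<delta> where \<delta>: "\<delta> > 0" "{a..<a + \<delta>} \<subseteq> V"
          using V(1) a(2) unfolding openin_sorgenfrey_line by blast
        \<comment> \<open>\<open>e < 1\<close> excludes the points to the left of \<open>a\<close>, and \<open>e < \<delta>\<close> those too far to the right\<close>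
        define e where "e = min (1 / 2) (\<delta> / 2)"
        have e: "e > 0" "e < 1" "e < \<delta>"
          using \<delta>(1) by (auto simp: e_def)
        obtain W where W: "openin gtop W" "?f a \<in> W" "W \<subseteq> {y\<in>K. small {a} e (diff (?f a) y)}"
          using ball_nbhd[of "?f a" "{a}" e] f[OF a(3)] e(1) by auto
        have "b \<in> V" if b: "b \<in> A" "?f b \<in> W" for b
        proof -
          have sm: "small {a} e (diff (?f a) (?f b))" using b W(3) by blast
          have "a \<le> b"
          proof (rule ccontr)
            assume "\<not> a \<le> b"
            then show False
              using sm small_interval_left[of a e b] e(2) diff[of b a] a(3) b(1) by auto
          qed
          moreover from this have "b - a \<le> e"
            using sm diff[of a b] a(3) b(1) by (auto simp: small_def)
          ultimately show ?thesis using \<delta>(2) e(3) by auto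
        qed
        then have "W \<inter> ?f ` A \<subseteq> ?f ` U"
          using V(2) by blast
        then show "\<exists>T. openin (subtopology gtop (?f ` A)) T \<and> x \<in> T \<and> T \<subseteq> ?f ` U"
          using W(1,2) a by (intro exI[of _ "W \<inter> ?f ` A"]) (auto simp: openin_subtopology)
      qed
    qed
    show "?f ` topspace (subtopology sorgenfrey_line A) = topspace (subtopology gtop (?f ` A))"
      using f by (auto simp: topspace_sorgenfrey_line topspace_gtop)
    show "inj_on ?f (topspace (subtopology sorgenfrey_line A))"
    proof (rule inj_onI)
      fix a b assume "a \<in> topspace (subtopology sorgenfrey_line A)" "b \<in> topspace (subtopology sorgenfrey_line A)"
        and eq: "?f a = ?f b"
      then have ab: "a \<in> A" "b \<in> A" by auto
      then have "{0..<a} = {0..<b}" using f(2) eq by metis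
      then show "a = b" using positive[OF ab(1)] positive[OF ab(2)] by (simp add: Ico_eq_Ico)
    qed
  qed
qed

end

section \<open>Cosmic spaces and spread\<close>

text \<open>The network consists of the images of the balls of radius \<open>1 / (n + 1)\<close> around a countable dense
  set.\<close>

lemma cosmic_countable_network:
  assumes "cosmic X"
  obtains \<N> where "countable \<N>"
    "\<And>U x. openin X U \<Longrightarrow> x \<in> U \<Longrightarrow> \<exists>N\<in>\<N>. x \<in> N \<and> N \<subseteq> U"
proof -
  obtain M :: "real topology" and f where M: "metrizable_space M" "separable_space M"
      "continuous_map M X f" "f ` topspace M = topspace X"
    using assms unfolding cosmic_def by blast
  obtain S d where Sd: "Metric_space S d" and M_eq: "M = Metric_space.mtopology S d"
    using M(1) unfolding metrizable_space_def by blast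
  interpret Metric_space S d by (rule Sd)
  obtain C where C: "countable C" "C \<subseteq> S" "mtopology closure_of C = S"
    using M(2) unfolding M_eq separable_space_def by auto
  let ?N = "(\<lambda>(c, n :: nat). f ` mball c (inverse (Suc n))) ` (C \<times> UNIV)"
  show thesis
  proof (rule that)
    show "countable ?N"
      using C(1) by blast
    fix U x assume U: "openin X U" "x \<in> U"
    then have "x \<in> f ` topspace M"
      using openin_subset[OF U(1)] M(4) by blast
    then obtain m where m: "m \<in> S" "f m = x"
      by (auto simp: M_eq)
    have "openin mtopology {z \<in> topspace mtopology. f z \<in> U}"
      using M(3) U(1) unfolding M_eq continuous_map_def by blast
    then obtain r where r: "r > 0" "mball m r \<subseteq> {z \<in> topspace mtopology. f z \<in> U}"
      using m U(2) unfolding openin_mtopology by auto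
    obtain n where n: "inverse (real (Suc n)) < r / 2"
      using reals_Archimedean[of "r / 2"] r(1) by auto
    have "m \<in> mtopology closure_of C" using C(3) m(1) by simp
    moreover have "0 < inverse (real (Suc n))" by simp
    ultimately obtain c where c: "c \<in> C" "c \<in> mball m (inverse (real (Suc n)))"
      unfolding metric_closure_of by blast
    have "mball c (inverse (real (Suc n))) \<subseteq> mball m r"
    proof
      fix z assume z: "z \<in> mball c (inverse (real (Suc n)))"
      then have "d m z \<le> d m c + d c z"
        using c m(1) by (intro triangle) auto
      then show "z \<in> mball m r"
        using z c n m(1) by auto
    qed
    then have "f ` mball c (inverse (real (Suc n))) \<subseteq> U"
      using r(2) by blast
    moreover have "x \<in> f ` mball c (inverse (real (Suc n)))"
      using m c by (auto simp: commute)
    ultimately show "\<exists>N\<in>?N. x \<in> N \<and> N \<subseteq> U"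
      using c(1) by blast
  qed
qed

text \<open>The neighbourhood \<open>[a, a + 1)\<close> of \<open>a\<close> contains a member of the network around \<open>a\<close>, and \<open>a\<close> is the
  least element of that member. So different points get different members.\<close>

lemma cosmic_Sorgenfrey_subspace_countable:
  assumes "cosmic X" "subtopology X S homeomorphic_space subtopology sorgenfrey_line A"
  shows "countable A"
proof -
  obtain \<N> where \<N>: "countable \<N>"
      "\<And>U x. openin X U \<Longrightarrow> x \<in> U \<Longrightarrow> \<exists>N\<in>\<N>. x \<in> N \<and> N \<subseteq> U"
    using cosmic_countable_network[OF assms(1)] by blast
  obtain h k where hk: "homeomorphic_maps (subtopology X S) (subtopology sorgenfrey_line A) h k"
    using assms(2) unfolding homeomorphic_space_def by blast
  have hk_id: "h (k a) = a" "k a \<in> topspace (subtopology X S)" if "a \<in> A" for a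
    using hk that unfolding homeomorphic_maps_def continuous_map_def
    by (auto simp: topspace_sorgenfrey_line Pi_iff)
  have "\<exists>N\<in>\<N>. k a \<in> N \<and> (\<forall>b\<in>A. k b \<in> N \<longrightarrow> a \<le> b)" if a: "a \<in> A" for a
  proof -
    have "openin (subtopology sorgenfrey_line A) ({a..<a + 1} \<inter> A)"
      using openin_sorgenfrey_line_Ico by (auto simp: openin_subtopology)
    then have "openin (subtopology X S) {z \<in> topspace (subtopology X S). h z \<in> {a..<a + 1} \<inter> A}"
      using hk unfolding homeomorphic_maps_def continuous_map_def by blast
    then obtain V where V: "openin X V"
        "{z \<in> topspace (subtopology X S). h z \<in> {a..<a + 1} \<inter> A} = V \<inter> S"
      unfolding openin_subtopology by blast
    have "k a \<in> {z \<in> topspace (subtopology X S). h z \<in> {a..<a + 1} \<inter> A}"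
      using a hk_id by simp
    then have "k a \<in> V" unfolding V(2) by blast
    then obtain N where N: "N \<in> \<N>" "k a \<in> N" "N \<subseteq> V"
      using \<N>(2) V(1) by blast
    have "a \<le> b" if "b \<in> A" "k b \<in> N" for b
    proof -
      have "k b \<in> V \<inter> S" using that N(3) hk_id(2)[OF that(1)] by auto
      then show ?thesis using hk_id(1)[OF that(1)] unfolding V(2)[symmetric] by simp
    qed
    then show ?thesis using N by blast
  qed
  then obtain N where N: "\<And>a. a \<in> A \<Longrightarrow> N a \<in> \<N>" "\<And>a. a \<in> A \<Longrightarrow> k a \<in> N a"
      "\<And>a b. a \<in> A \<Longrightarrow> b \<in> A \<Longrightarrow> k b \<in> N a \<Longrightarrow> a \<le> b"
    by metis
  have "inj_on N A"
    using N(2,3) by (intro inj_onI antisym) metis+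
  moreover have "countable (N ` A)"
    using N(1) by (intro countable_subset[OF _ \<N>(1)]) blast
  ultimately show ?thesis
    by (simp add: countable_image_inj_eq)
qed

text \<open>By definition the spread is compared only with cardinals over the type of the points, so \<open>natLeq\<close>
  is represented there by a countable set \<open>C\<close> into which every countable set embeds.\<close>

lemma hereditarily_Lindelof_imp_spread_countable:
  fixes X :: "'a topology"
  assumes "hereditarily_Lindelof X"
  shows "spread X \<le>o natLeq"
proof -
  have D: "countable D" if "discrete_subspace X D" for D
  proof -
    have "Lindelof_space (discrete_topology D)"
      using that assms unfolding discrete_subspace_def hereditarily_Lindelof_def by metis
    then obtain V where V: "countable V" "V \<subseteq> (\<lambda>x. {x}) ` D" "\<Union>V = D"
      unfolding Lindelof_space_def by (elim allE[of _ "(\<lambda>x. {x}) ` D"]) auto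
    then have "countable (\<Union>v\<in>V. v)"
      by (intro countable_UN) auto
    then show ?thesis by (simp add: V(3))
  qed
  have "\<exists>C :: 'a set. countable C \<and> (\<forall>D :: 'a set. countable D \<longrightarrow> |D| \<le>o |C| )"
  proof (cases "finite (UNIV :: 'a set)")
    case True
    then show ?thesis
      by (intro exI[of _ UNIV]) (simp add: countable_finite card_of_mono1)
  next
    case False
    then obtain C :: "'a set" where C: "countable C" "infinite C"
      using infinite_countable_subset' by blast
    have "|D| \<le>o |C|" if "countable D" for D :: "'a set"
      using that C(2) countable_card_of_nat infinite_iff_card_of_nat ordLeq_transitive by blast
    then show ?thesis using C(1) by blast
  qed
  then obtain C :: "'a set" where C: "countable C" "\<And>D :: 'a set. countable D \<Longrightarrow> |D| \<le>o |C|"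
    by blast
  have "spread X \<le>o |C|"
    using is_spread_spread[of X] C(2) D unfolding is_spread_def
    by (metis card_of_Card_order)
  also have "|C| \<le>o natLeq"
    using C(1) by (simp add: countable_card_le_natLeq)
  finally show ?thesis .
qed

section \<open>The cometrizable group\<close>

theorem theorem5:
  assumes "continuum_hypothesis"
  shows "\<exists>(G :: real monoid) (T :: real topology).
    topological_group G T \<and>
    cometrizable T \<and>
    (\<exists>S A. S \<subseteq> topspace T \<and> uncountable A \<and>
       subtopology T S homeomorphic_space subtopology sorgenfrey_line A) \<and>
    \<not> cosmic T \<and>
    hereditarily_Lindelof (product_topology (\<lambda>_ :: nat. T) UNIV) \<and>
    spread (product_topology (\<lambda>_ :: nat. T) UNIV) \<le>o natLeq"
proof -
  obtain A where A: "uncountable A" "\<And>a. a \<in> A \<Longrightarrow> a > 0" "countably_dominated A"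
    using CH_imp_countably_dominated[OF assms] by blast
  obtain code :: "real set \<Rightarrow> real" where "inj_on code (range step_set)"
    using step_sets_lepoll_reals unfolding lepoll_def by blast
  then have inj: "inj_on code (step_set ` lists A)"
    by (rule inj_on_subset) blast
  define K where "K = code ` step_set ` lists A"
  define \<sigma> where "\<sigma> = inv_into (step_set ` lists A) code"
  have "bij_betw \<sigma> K (step_set ` lists A)"
    unfolding K_def \<sigma>_def using inj by (intro bij_betw_inv_into) (simp add: bij_betw_def)
  then interpret step_group A K \<sigma>
    using A(2) by unfold_locales
  have sub: "(\<lambda>a. elt [a]) ` A \<subseteq> topspace gtop"
    using elt(1)[of "[_]"] by (auto simp: topspace_gtop)
  have emb: "subtopology gtop ((\<lambda>a. elt [a]) ` A) homeomorphic_space subtopology sorgenfrey_line A"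
    using Sorgenfrey_embedding homeomorphic_map_imp_homeomorphic_space homeomorphic_space_sym by blast
  have "\<not> cosmic gtop"
    using cosmic_Sorgenfrey_subspace_countable[OF _ emb] A(1) by blast
  then show ?thesis
    using topological_group_gtop cometrizable_gtop sub emb A(1)
      hereditarily_Lindelof_power[OF A(3)] hereditarily_Lindelof_imp_spread_countable
    by blast
qed

end
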